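(* Let $d\geq 2$. Then no effective action $\varphi\in\mathcal{H}(d)$ has a dense conjugacy class $[\varphi]$ in $\mathcal{H}(d)$.
   Context: $K=\{0,1\}^{\mathbb{N}}$ is the Cantor set and $\mathcal{H}=\mathrm{homeo}(K)$ is the Polish group of homeomorphisms of $K$ with the topology of uniform convergence. $\mathcal{H}(d)=\mathrm{Hom}(\mathbb{Z}^{d},\mathcal{H})$ is the space of continuous $\mathbb{Z}^{d}$-actions $\varphi=\{\varphi^{u}\}_{u\in\mathbb{Z}^{d}}$ on $K$, with the Polish topology inherited as a closed subset of the product $\mathcal{H}^{\mathbb{Z}^{d}}$. The conjugacy class of $\varphi$ is $[\varphi]=\{\{\pi\varphi^{u}\pi^{-1}\}_{u\in\mathbb{Z}^{d}} : \pi\in\mathcal{H}\}$. Effectiveness: a finite sequence $\{(C_{i},u_{i})\}_{i=1}^{n}$ of pairs, with $C_{i}\subseteq K$ a cylinder set and $u_{i}\in\mathbb{Z}^{d}$, is $\varphi$-disjoint if $\bigcap_{i=1}^{n}\varphi^{u_{i}}C_{i}=\emptyset$. Finite sequences of this kind are identified with integers by a fixed standard effective coding. The action $\varphi$ is effective if the set of $\varphi$-disjoint sequences is recursively enumerable. *)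

theory Defs
  imports "HOL-Analysis.Analysis" "HOL-Algebra.Product_Groups" "HOL-Library.Nat_Bijection"
begin

section \<open>Recursively enumerable sets of natural numbers\<close>

datatype recf =
    Zero
  | Succ
  | Proj nat
  | Comp recf "recf list"
  | PrimRec recf recf
  | Mu recf

text \<open>
  \<open>computes f xs y\<close>: the Kleene scheme \<open>f\<close> halts on the argument tuple \<open>xs\<close> with value \<open>y\<close>.
  Arities are not tracked: \<^term>\<open>Zero\<close> is the constant zero function of every arity, and a
  projection onto an absent argument is undefined.  Recursion is on the first argument, with
  the step function called on (counter, previous value, parameters); \<^term>\<open>Mu\<close> searches over
  the first argument and requires all earlier values to be defined and nonzero.
\<close>

inductive computes :: "recf \<Rightarrow> nat list \<Rightarrow> nat \<Rightarrow> bool" where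
  zero: "computes Zero xs 0"
| succ: "computes Succ (x # xs) (Suc x)"
| proj: "i < length xs \<Longrightarrow> computes (Proj i) xs (xs ! i)"
| comp: "length ys = length gs \<Longrightarrow> (\<forall>i < length gs. computes (gs ! i) xs (ys ! i)) \<Longrightarrow>
    computes f ys z \<Longrightarrow> computes (Comp f gs) xs z"
| rec_zero: "computes f xs y \<Longrightarrow> computes (PrimRec f g) (0 # xs) y"
| rec_suc: "computes (PrimRec f g) (n # xs) y \<Longrightarrow> computes g (n # y # xs) z \<Longrightarrow>
    computes (PrimRec f g) (Suc n # xs) z"
| mu: "computes f (n # xs) 0 \<Longrightarrow> (\<forall>m < n. \<exists>y > 0. computes f (m # xs) y) \<Longrightarrow>
    computes (Mu f) xs n"

lemma computes_deterministic: "computes f xs y \<Longrightarrow> computes f xs z \<Longrightarrow> y = z"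
proof (induction arbitrary: z rule: computes.induct)
  case (zero xs)
  then show ?case by (auto elim: computes.cases)
next
  case (succ x xs)
  then show ?case by (auto elim: computes.cases)
next
  case (proj i xs)
  from proj.prems show ?case by cases auto
next
  case (comp ys gs xs f w)
  from comp.prems show ?case
  proof cases
    case (comp ys')
    then have "ys = ys'"
      using comp.hyps(1) comp.IH(1) by (auto intro!: nth_equalityI)
    then show ?thesis using comp comp.IH(2) by simp
  qed
next
  case (rec_zero f xs y g)
  from rec_zero.prems show ?case by cases (use rec_zero.IH in auto)
next
  case (rec_suc f g n xs y w)
  from rec_suc.prems show ?case by cases (use rec_suc.IH in auto)
next
  case (mu f n xs)
  from mu.prems show ?case
  proof cases
    case mu
    show ?thesis
    proof (rule linorder_cases)
      assume "n < z"
      then obtain y where "y > 0" "computes f (n # xs) y" using mu by blast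
      then show ?thesis using mu.IH(1) by blast
    next
      assume "z < n"
      then show ?thesis using mu mu.IH(2) by blast
    qed
  qed
qed

definition recursively_enumerable :: "nat set \<Rightarrow> bool" where
  "recursively_enumerable A \<longleftrightarrow> (\<exists>f. A = {n. \<exists>y. computes f [n] y})"


section \<open>The Cantor set and its homeomorphism group\<close>

text \<open>
  The Cantor set is the type \<^typ>\<open>nat \<Rightarrow> bool\<close> with the product topology of its
  \<^class>\<open>topological_space\<close> instance.  Uniform convergence refers to the usual compatible
  metric \<open>cantor_dist\<close>; by compactness the choice of compatible metric is immaterial.
\<close>

type_synonym cantor = "nat \<Rightarrow> bool"

definition cantor_dist :: "cantor \<Rightarrow> cantor \<Rightarrow> real" where
  "cantor_dist x y = (if x = y then 0 else (1/2) ^ (LEAST n. x n \<noteq> y n))"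

lemma cantor_dist_less_iff: "cantor_dist x y < (1/2) ^ n \<longleftrightarrow> (\<forall>i\<le>n. x i = y i)"
proof (cases "x = y")
  case False
  define m where "m = (LEAST n. x n \<noteq> y n)"
  have "\<exists>n. x n \<noteq> y n" using False by auto
  then have m: "x m \<noteq> y m" unfolding m_def by (rule LeastI_ex)
  have m': "x i = y i" if "i < m" for i
    using not_less_Least that unfolding m_def by blast
  have "cantor_dist x y < (1/2) ^ n \<longleftrightarrow> n < m"
    using False by (simp add: cantor_dist_def m_def power_strict_decreasing_iff)
  also have "\<dots> \<longleftrightarrow> (\<forall>i\<le>n. x i = y i)"
    using m m' by (meson leI le_less_trans)
  finally show ?thesis .
qed (simp add: cantor_dist_def)

lemma cantor_dist_bounds: "0 \<le> cantor_dist x y" "cantor_dist x y \<le> 1"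
  by (auto simp: cantor_dist_def power_le_one)

lemma cantor_dist_ultra: "cantor_dist x z \<le> max (cantor_dist x y) (cantor_dist y z)"
proof (cases "x = z \<or> x = y \<or> y = z")
  case True
  then show ?thesis using cantor_dist_bounds by (auto simp: max_def cantor_dist_def)
next
  case False
  define m where "m = (LEAST n. x n \<noteq> z n)"
  have "\<exists>n. x n \<noteq> z n" using False by auto
  then have m: "x m \<noteq> z m" unfolding m_def by (rule LeastI_ex)
  have "\<not> (cantor_dist x y < (1/2) ^ m \<and> cantor_dist y z < (1/2) ^ m)"
    using m by (auto simp: cantor_dist_less_iff)
  moreover have "cantor_dist x z = (1/2) ^ m"
    using False by (simp add: cantor_dist_def m_def)
  ultimately show ?thesis by linarith
qed

lemma Metric_space_cantor_dist: "Metric_space UNIV cantor_dist"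
proof
  show "0 \<le> cantor_dist x y" for x y by (rule cantor_dist_bounds)
  show "cantor_dist x y = cantor_dist y x" for x y
    by (simp add: cantor_dist_def eq_commute)
  show "(cantor_dist x y = 0) = (x = y)" for x y by (simp add: cantor_dist_def)
  show "cantor_dist x z \<le> cantor_dist x y + cantor_dist y z" for x y z
    using cantor_dist_ultra[of x z y] cantor_dist_bounds[of x y] cantor_dist_bounds[of y z]
    by linarith
qed

lemma mtopology_cantor_dist: "Metric_space.mtopology UNIV cantor_dist = euclidean"
proof -
  interpret Metric_space UNIV cantor_dist by (rule Metric_space_cantor_dist)
  have "openin mtopology U \<longleftrightarrow> open U" for U
  proof
    assume U: "openin mtopology U"
    show "open U"
    proof (subst open_subopen, intro ballI)
      fix x assume "x \<in> U"
      then obtain r where r: "r > 0" "mball x r \<subseteq> U"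
        using U openin_mtopology by blast
      then obtain n where n: "(1/2) ^ n < r"
        using real_arch_pow_inv[of r "1/2"] by auto
      let ?V = "{y. \<forall>i\<in>{..n}. y i \<in> {x i}}"
      have "open ?V"
        by (rule product_topology_basis'[of "{..n}" "\<lambda>i. {x i}" "\<lambda>i. i"])
          (auto intro: open_discrete)
      moreover have "?V \<subseteq> U"
      proof
        fix y assume "y \<in> ?V"
        then have "cantor_dist x y < (1/2) ^ n" by (subst cantor_dist_less_iff) auto
        then have "y \<in> mball x r" using n unfolding in_mball by (meson UNIV_I less_trans)
        then show "y \<in> U" using r by blast
      qed
      ultimately show "\<exists>T. open T \<and> x \<in> T \<and> T \<subseteq> U" by (intro exI[of _ ?V]) auto
    qed
  next
    assume "open U"
    then have U: "openin (product_topology (\<lambda>_. euclidean) UNIV) U"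
      by (simp add: open_fun_def)
    show "openin mtopology U"
      unfolding openin_mtopology
    proof (intro conjI allI impI)
      fix x assume "x \<in> U"
      obtain X where X: "x \<in> Pi\<^sub>E UNIV X" "finite {i. X i \<noteq> topspace euclidean}"
          "Pi\<^sub>E UNIV X \<subseteq> U"
        using product_topology_open_contains_basis[OF U \<open>x \<in> U\<close>] by blast
      then obtain n where n: "\<And>i. X i \<noteq> UNIV \<Longrightarrow> i \<le> n"
        unfolding finite_nat_set_iff_bounded_le by auto
      have "mball x ((1/2) ^ n) \<subseteq> Pi\<^sub>E UNIV X"
      proof
        fix y assume "y \<in> mball x ((1/2) ^ n)"
        then have eq: "\<forall>i\<le>n. x i = y i"
          unfolding in_mball cantor_dist_less_iff by blast
        have "y i \<in> X i" for i
        proof (cases "X i = UNIV")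
          case False
          then have "x i = y i" using n eq by blast
          moreover have "x i \<in> X i" using X(1) by (rule PiE_mem) simp
          ultimately show ?thesis by (simp only:)
        qed simp
        then show "y \<in> Pi\<^sub>E UNIV X" by auto
      qed
      then show "\<exists>r>0. mball x r \<subseteq> U" using X(3) by (intro exI[of _ "(1/2) ^ n"]) auto
    qed auto
  qed
  then show ?thesis by (simp only: topology_eq open_openin[symmetric] simp_thms)
qed

definition homeo_group :: "(cantor \<Rightarrow> cantor) monoid" where
  "homeo_group = \<lparr>carrier = {f. \<exists>g. homeomorphism UNIV UNIV f g}, monoid.mult = (\<circ>), one = id\<rparr>"

lemma group_homeo_group: "group homeo_group"
proof (rule groupI)
  fix f g assume "f \<in> carrier homeo_group" "g \<in> carrier homeo_group"
  then show "f \<otimes>\<^bsub>homeo_group\<^esub> g \<in> carrier homeo_group"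
    by (auto simp: homeo_group_def intro: homeomorphism_compose)
next
  fix f assume "f \<in> carrier homeo_group"
  then obtain g where g: "homeomorphism UNIV UNIV f g" by (auto simp: homeo_group_def)
  then have "g \<circ> f = id" by (auto simp: homeomorphism_def)
  then show "\<exists>g\<in>carrier homeo_group. g \<otimes>\<^bsub>homeo_group\<^esub> f = \<one>\<^bsub>homeo_group\<^esub>"
    using homeomorphism_symD[OF g] unfolding homeo_group_def
    by (intro bexI[of _ g]) (simp_all, metis)
next
  have "homeomorphism UNIV UNIV id id" by (simp add: homeomorphism_def)
  then show "\<one>\<^bsub>homeo_group\<^esub> \<in> carrier homeo_group" unfolding homeo_group_def by auto
qed (simp_all add: homeo_group_def o_assoc)

definition homeo_dist :: "(cantor \<Rightarrow> cantor) \<Rightarrow> (cantor \<Rightarrow> cantor) \<Rightarrow> real" where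
  "homeo_dist f g = (SUP x. cantor_dist (f x) (g x))"

lemma Metric_space_homeo_dist: "Metric_space (carrier homeo_group) homeo_dist"
proof
  have bdd: "bdd_above (range (\<lambda>x. cantor_dist (f x) (g x)))" for f g :: "cantor \<Rightarrow> cantor"
    using cantor_dist_bounds by (intro bdd_aboveI[of _ 1]) auto
  have le: "cantor_dist (f x) (g x) \<le> homeo_dist f g" for f g x
    unfolding homeo_dist_def by (rule cSUP_upper[OF _ bdd]) simp
  interpret C: Metric_space UNIV cantor_dist by (rule Metric_space_cantor_dist)
  show nonneg: "0 \<le> homeo_dist f g" for f g
    using le cantor_dist_bounds(1) order_trans by blast
  show "homeo_dist f g = homeo_dist g f" for f g
    by (simp add: homeo_dist_def C.commute)
  show "(homeo_dist f g = 0) = (f = g)" for f g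
  proof
    assume "homeo_dist f g = 0"
    then have "cantor_dist (f x) (g x) = 0" for x
      using le[of f x g] cantor_dist_bounds(1)[of "f x" "g x"] by linarith
    then show "f = g" by auto
  qed (simp add: homeo_dist_def cantor_dist_def)
  show "homeo_dist f h \<le> homeo_dist f g + homeo_dist g h" for f g h
  proof -
    have "cantor_dist (f x) (h x) \<le> homeo_dist f g + homeo_dist g h" for x
      using C.triangle[of "f x" "g x" "h x"] le[of f x g] le[of g x h] by simp
    then show ?thesis
      unfolding homeo_dist_def[of f h] by (intro cSUP_least) auto
  qed
qed

definition homeo_topology :: "(cantor \<Rightarrow> cantor) topology" where
  "homeo_topology = Metric_space.mtopology (carrier homeo_group) homeo_dist"


section \<open>The space of actions\<close>

definition int_lattice :: "nat \<Rightarrow> (nat \<Rightarrow> int) monoid" where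
  "int_lattice d = product_group {..<d} (\<lambda>_. integer_group)"

text \<open>
  Members of \<^const>\<open>hom\<close> are unconstrained outside the carrier; passing to a subspace of the
  product topology keeps exactly the homomorphisms that are extensional on the carrier.
\<close>

definition action_space :: "nat \<Rightarrow> ((nat \<Rightarrow> int) \<Rightarrow> cantor \<Rightarrow> cantor) topology" where
  "action_space d = subtopology (product_topology (\<lambda>_. homeo_topology) (carrier (int_lattice d)))
     (hom (int_lattice d) homeo_group)"

lemma topspace_action_space:
  "topspace (action_space d) =
    hom (int_lattice d) homeo_group \<inter> extensional (carrier (int_lattice d))"
proof -
  interpret Metric_space "carrier homeo_group" homeo_dist by (rule Metric_space_homeo_dist)
  show ?thesis
    by (auto simp: action_space_def homeo_topology_def hom_def PiE_def)
qed

definition conjugacy_class ::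
  "nat \<Rightarrow> ((nat \<Rightarrow> int) \<Rightarrow> cantor \<Rightarrow> cantor) \<Rightarrow> ((nat \<Rightarrow> int) \<Rightarrow> cantor \<Rightarrow> cantor) set" where
  "conjugacy_class d \<phi> =
    {(\<lambda>u\<in>carrier (int_lattice d). \<pi> \<circ> \<phi> u \<circ> \<pi>') | \<pi> \<pi>'. homeomorphism UNIV UNIV \<pi> \<pi>'}"

lemma conjugacy_class_subset:
  assumes "\<phi> \<in> topspace (action_space d)"
  shows "conjugacy_class d \<phi> \<subseteq> topspace (action_space d)"
proof
  fix \<psi> assume "\<psi> \<in> conjugacy_class d \<phi>"
  then obtain \<pi> \<pi>' where h: "homeomorphism UNIV UNIV \<pi> \<pi>'"
      and \<psi>: "\<psi> = (\<lambda>u\<in>carrier (int_lattice d). \<pi> \<circ> \<phi> u \<circ> \<pi>')"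
    by (auto simp: conjugacy_class_def)
  interpret H: group homeo_group by (rule group_homeo_group)
  interpret L: group "int_lattice d" by (simp add: int_lattice_def)
  have \<phi>: "\<phi> \<in> hom (int_lattice d) homeo_group" using assms by (simp add: topspace_action_space)
  have \<pi>: "\<pi> \<in> carrier homeo_group" "\<pi>' \<in> carrier homeo_group" "\<And>x. \<pi>' (\<pi> x) = x"
    using h homeomorphism_symD[OF h] by (auto simp: homeo_group_def homeomorphism_def)
  have mult: "f \<otimes>\<^bsub>homeo_group\<^esub> g = f \<circ> g" for f g by (simp add: homeo_group_def)
  have "\<psi> \<in> hom (int_lattice d) homeo_group"
  proof (rule homI)
    fix u assume u: "u \<in> carrier (int_lattice d)"
    have "\<phi> u \<in> carrier homeo_group" using \<phi> u by (rule hom_in_carrier)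
    then have "\<pi> \<otimes>\<^bsub>homeo_group\<^esub> \<phi> u \<otimes>\<^bsub>homeo_group\<^esub> \<pi>' \<in> carrier homeo_group"
      using \<pi> by (intro H.m_closed)
    then show "\<psi> u \<in> carrier homeo_group" using u by (simp add: \<psi> mult)
  next
    fix u v assume uv: "u \<in> carrier (int_lattice d)" "v \<in> carrier (int_lattice d)"
    then have "\<phi> (u \<otimes>\<^bsub>int_lattice d\<^esub> v) = \<phi> u \<circ> \<phi> v"
      using hom_mult[OF \<phi>] by (simp add: mult)
    then show "\<psi> (u \<otimes>\<^bsub>int_lattice d\<^esub> v) = \<psi> u \<otimes>\<^bsub>homeo_group\<^esub> \<psi> v"
      using uv by (simp add: \<psi> mult) (simp only: o_def \<pi>(3))
  qed
  then show "\<psi> \<in> topspace (action_space d)"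
    by (simp add: topspace_action_space \<psi>)
qed


section \<open>Effective actions\<close>

text \<open>
  A cylinder set fixes finitely many coordinates.  It is presented by a list \<open>p\<close> in which
  \<open>p ! i = Some b\<close> prescribes the value \<open>b\<close> at coordinate \<open>i\<close>, while \<open>None\<close>, as well as any
  position beyond the end of the list, imposes no condition.
\<close>

type_synonym pattern = "bool option list"

definition cylinder :: "pattern \<Rightarrow> cantor set" where
  "cylinder p = {x. \<forall>i < length p. \<forall>b. p ! i = Some b \<longrightarrow> x i = b}"

definition disjoint_seq ::
  "((nat \<Rightarrow> int) \<Rightarrow> cantor \<Rightarrow> cantor) \<Rightarrow> (pattern \<times> (nat \<Rightarrow> int)) list \<Rightarrow> bool" where
  "disjoint_seq \<phi> s \<longleftrightarrow> (\<Inter>(p, u)\<in>set s. \<phi> u ` cylinder p) = {}"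

definition pattern_code :: "pattern \<Rightarrow> nat" where
  "pattern_code p = list_encode (map (\<lambda>a. case a of None \<Rightarrow> 0 | Some b \<Rightarrow> if b then 2 else 1) p)"

definition vector_code :: "nat \<Rightarrow> (nat \<Rightarrow> int) \<Rightarrow> nat" where
  "vector_code d u = list_encode (map (\<lambda>i. int_encode (u i)) [0..<d])"

definition seq_code :: "nat \<Rightarrow> (pattern \<times> (nat \<Rightarrow> int)) list \<Rightarrow> nat" where
  "seq_code d s = list_encode (map (\<lambda>(p, u). prod_encode (pattern_code p, vector_code d u)) s)"

lemma inj_pattern_code: "inj pattern_code"
proof (rule injI)
  fix p q :: pattern
  define c :: "bool option \<Rightarrow> nat"
    where "c a = (case a of None \<Rightarrow> 0 | Some b \<Rightarrow> if b then 2 else 1)" for a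
  have "inj c" by (auto simp: inj_def c_def split: option.splits if_splits)
  moreover assume "pattern_code p = pattern_code q"
  then have "map c p = map c q"
    by (simp add: pattern_code_def c_def[abs_def] list_encode_eq)
  ultimately show "p = q" by simp
qed

lemma inj_on_vector_code: "inj_on (vector_code d) (carrier (int_lattice d))"
proof (rule inj_onI)
  fix u v assume "u \<in> carrier (int_lattice d)" "v \<in> carrier (int_lattice d)"
    and "vector_code d u = vector_code d v"
  then show "u = v"
    by (intro PiE_ext[of u "{..<d}" "\<lambda>_. UNIV" v])
      (auto simp: int_lattice_def vector_code_def list_encode_eq int_encode_eq)
qed

lemma inj_on_seq_code: "inj_on (seq_code d) (lists (UNIV \<times> carrier (int_lattice d)))"
proof -
  let ?c = "\<lambda>(p, u). prod_encode (pattern_code p, vector_code d u)"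
  have "inj_on ?c (UNIV \<times> carrier (int_lattice d))"
    using inj_pattern_code inj_on_vector_code by (auto simp: inj_on_def)
  then have "inj_on (map ?c) (lists (UNIV \<times> carrier (int_lattice d)))"
    by (rule inj_on_mapI[OF inj_on_subset]) auto
  then show ?thesis
    by (auto simp: inj_on_def seq_code_def list_encode_eq)
qed

definition effective :: "nat \<Rightarrow> ((nat \<Rightarrow> int) \<Rightarrow> cantor \<Rightarrow> cantor) \<Rightarrow> bool" where
  "effective d \<phi> \<longleftrightarrow>
    recursively_enumerable
      (seq_code d ` {s \<in> lists (UNIV \<times> carrier (int_lattice d)). disjoint_seq \<phi> s})"

end

theory Submission
  imports Defs
begin

text \<open>
  The reason is an undecidability phenomenon for tilings of the plane.  A finite set of labels together with
  a finite set of allowed windows of four neighbouring cells is a tile set; for an action \<open>\<phi>\<close>, a clopen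
  partition into labelled pieces that respects the tile set labels the orbit of every point by a valid tiling.
  A seed restricts the labels of finitely many cells of the tiling.
  
  If \<open>\<phi>\<close> has a dense conjugacy class, then it is generic for this question: a seeded tiling exists if
  and only if \<open>\<phi>\<close> has a clopen partition that respects the tile set and has a cylinder of points whose orbits
  satisfy the seed.  Indeed a seeded tiling \<open>X\<close> gives an action \<open>\<psi>\<close> with such a partition, namely the
  translations on the orbit closure of \<open>X\<close>, multiplied by a Cantor set in order that the phase space becomes the
  Cantor set (\<open>tiling_action\<close>); a conjugate of \<open>\<phi>\<close> close to \<open>\<psi>\<close> inherits the partition
  (\<open>clopen_tiling_complete\<close>).  Conversely every orbit through the cylinder is a seeded tiling
  (\<open>clopen_tiling_sound\<close>).
  
  If \<open>\<phi>\<close> is also effective, then the existence of such a partition and cylinder is recursively enumerable,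
  because each forbidden pattern is excluded by a \<open>\<phi>\<close>-disjoint sequence (\<open>clopen_tiling_RE\<close>).  So the
  existence of seeded tilings would be recursively enumerable.  But already for one suitable tile set it is not: tilings
  can draw the run of a register machine row by row, with a seed that specifies the input, such that a seeded tiling
  exists exactly when the machine runs forever (\<open>seeded_tilings_encode_halting\<close>), and there is a machine whose set
  of non-halting inputs is not recursively enumerable (\<open>RE_halting_program\<close>, \<open>self_acceptance_not_co_RE\<close>).
  
  Prescribing a seed is essential for keeping the simulation elementary.  It is admissible because nonemptiness of
  the seed is witnessed by a cylinder; without a seed one would need the undecidability of the
  domino problem, which rests on aperiodic tile sets.
\<close>

section \<open>Primitive recursive functions\<close>

text \<open>
  Primitive recursiveness is a property of functions, so that it can be established by
  introduction rules along the syntax of a term and used by rule induction twice: to produce a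
  Kleene scheme, and to produce a register program.  Values on argument lists of the wrong length
  are irrelevant, which is what \<open>cong\<close> expresses.
\<close>

inductive primrec_fn :: "nat \<Rightarrow> (nat list \<Rightarrow> nat) \<Rightarrow> bool" where
  zero: "primrec_fn k (\<lambda>_. 0)"
| succ: "primrec_fn 1 (\<lambda>xs. Suc (xs ! 0))"
| proj: "i < k \<Longrightarrow> primrec_fn k (\<lambda>xs. xs ! i)"
| comp: "primrec_fn (length Gs) F \<Longrightarrow> \<forall>G \<in> set Gs. primrec_fn k G \<Longrightarrow>
    primrec_fn k (\<lambda>xs. F (map (\<lambda>G. G xs) Gs))"
| prec: "primrec_fn k F \<Longrightarrow> primrec_fn (Suc (Suc k)) G \<Longrightarrow>
    primrec_fn (Suc k) (\<lambda>xs. rec_nat (F (tl xs)) (\<lambda>n y. G (n # y # tl xs)) (hd xs))"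
| cong: "primrec_fn k F \<Longrightarrow> \<forall>xs. length xs = k \<longrightarrow> F xs = F' xs \<Longrightarrow> primrec_fn k F'"

lemma primrec_fn_computes:
  "primrec_fn k F \<Longrightarrow> \<exists>g. \<forall>xs. length xs = k \<longrightarrow> computes g xs (F xs)"
proof (induction rule: primrec_fn.induct)
  case (zero k)
  show ?case by (intro exI[of _ Zero]) (auto intro: computes.zero)
next
  case succ
  have "computes Succ xs (Suc (xs ! 0))" if "length xs = 1" for xs
    using that by (cases xs) (auto intro: computes.succ)
  then show ?case by blast
next
  case (proj i k)
  then show ?case by (intro exI[of _ "Proj i"]) (auto intro: computes.proj)
next
  case (comp Gs F k)
  from comp.IH(1) obtain f where f: "\<And>xs. length xs = length Gs \<Longrightarrow> computes f xs (F xs)"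
    by blast
  from comp.IH(2) have "\<forall>G\<in>set Gs. \<exists>g. \<forall>xs. length xs = k \<longrightarrow> computes g xs (G xs)" by auto
  then obtain c where c: "\<And>G xs. G \<in> set Gs \<Longrightarrow> length xs = k \<Longrightarrow> computes (c G) xs (G xs)"
    by metis
  show ?case
    by (intro exI[of _ "Comp f (map c Gs)"] allI impI
        computes.comp[where ys = "map (\<lambda>G. G xs) Gs" for xs]) (auto intro: c f)
next
  case (prec k F G)
  then obtain f g where f: "\<And>xs. length xs = k \<Longrightarrow> computes f xs (F xs)"
    and g: "\<And>xs. length xs = Suc (Suc k) \<Longrightarrow> computes g xs (G xs)" by blast
  have "computes (PrimRec f g) (n # xs) (rec_nat (F xs) (\<lambda>n y. G (n # y # xs)) n)"
    if "length xs = k" for n xs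
    by (induction n) (auto intro!: computes.rec_zero computes.rec_suc f g that)
  then have "computes (PrimRec f g) xs (rec_nat (F (tl xs)) (\<lambda>n y. G (n # y # tl xs)) (hd xs))"
    if "length xs = Suc k" for xs using that by (cases xs) auto
  then show ?case by blast
next
  case (cong k F F')
  then show ?case by metis
qed

lemma primrec_fn_app1:
  assumes "primrec_fn 1 (\<lambda>xs. h (xs ! 0))" "primrec_fn k F"
  shows "primrec_fn k (\<lambda>xs. h (F xs))"
  using primrec_fn.comp[of "[F]" "\<lambda>xs. h (xs ! 0)" k] assms by simp

lemma primrec_fn_app2:
  assumes "primrec_fn 2 (\<lambda>xs. h (xs ! 0) (xs ! 1))" "primrec_fn k F" "primrec_fn k G"
  shows "primrec_fn k (\<lambda>xs. h (F xs) (G xs))"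
  using primrec_fn.comp[of "[F, G]" "\<lambda>xs. h (xs ! 0) (xs ! 1)" k] assms
  by (simp add: numeral_2_eq_2)

text \<open>
  Primitive recursion in the form in which all arguments may be used everywhere: the recursion
  argument is computed from the parameters, so the term \<open>rec_nat\<close> can occur inside other terms.
\<close>

lemma primrec_fn_rec:
  assumes A: "primrec_fn k A" and N: "primrec_fn k N"
    and S: "primrec_fn (Suc (Suc k)) (\<lambda>ys. S (ys ! 0) (ys ! 1) (drop 2 ys))"
  shows "primrec_fn k (\<lambda>xs. rec_nat (A xs) (\<lambda>n y. S n y xs) (N xs))"
proof -
  let ?H = "\<lambda>xs. rec_nat (A (tl xs)) (\<lambda>n y. S n y (tl xs)) (hd xs)"
  have H: "primrec_fn (Suc k) ?H"
    using primrec_fn.prec[OF A S] by simp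
  let ?Gs = "N # map (\<lambda>i xs. xs ! i) [0..<k]"
  have "primrec_fn k (\<lambda>xs. ?H (map (\<lambda>G. G xs) ?Gs))"
    using H N by (intro primrec_fn.comp) (auto intro: primrec_fn.proj)
  then show ?thesis
  proof (rule primrec_fn.cong, intro allI impI)
    fix xs :: "nat list" assume "length xs = k"
    then have "map (\<lambda>G. G xs) (map (\<lambda>i xs. xs ! i) [0..<k]) = xs"
      by (auto simp: comp_def intro: nth_equalityI)
    then show "?H (map (\<lambda>G. G xs) ?Gs) = rec_nat (A xs) (\<lambda>n y. S n y xs) (N xs)" by simp
  qed
qed

lemma primrec_fn_Suc: "primrec_fn k F \<Longrightarrow> primrec_fn k (\<lambda>xs. Suc (F xs))"
  using primrec_fn_app1 primrec_fn.succ by blast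

lemma primrec_fn_drop2: "i < k \<Longrightarrow> primrec_fn (Suc (Suc k)) (\<lambda>ys. drop 2 ys ! i)"
  by (rule primrec_fn.cong[OF primrec_fn.proj[of "Suc (Suc i)"]]) auto

lemma primrec_fn_pred: "primrec_fn k F \<Longrightarrow> primrec_fn k (\<lambda>xs. F xs - 1)"
proof (rule primrec_fn_app1[where h = "\<lambda>x. x - 1"])
  have "primrec_fn 1 (\<lambda>xs. rec_nat 0 (\<lambda>n y. n) (xs ! 0))"
    by (intro primrec_fn_rec primrec_fn.zero primrec_fn.proj) auto
  moreover have eq: "rec_nat 0 (\<lambda>n y. n) n = n - 1" for n :: nat by (cases n) auto
  ultimately show "primrec_fn 1 (\<lambda>xs. xs ! 0 - 1)" by (simp only: eq)
qed

lemma primrec_fn_add: "primrec_fn k F \<Longrightarrow> primrec_fn k G \<Longrightarrow> primrec_fn k (\<lambda>xs. F xs + G xs)"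
proof (rule primrec_fn_app2[where h = "(+)"])
  have "primrec_fn 2 (\<lambda>xs. rec_nat (xs ! 1) (\<lambda>n y. Suc y) (xs ! 0))"
    by (intro primrec_fn_rec primrec_fn_Suc primrec_fn.proj) auto
  moreover have eq: "rec_nat m (\<lambda>n y. Suc y) n = n + m" for n m :: nat by (induction n) auto
  ultimately show "primrec_fn 2 (\<lambda>xs. xs ! 0 + xs ! 1)" by (simp only: eq)
qed

lemma primrec_fn_diff: "primrec_fn k F \<Longrightarrow> primrec_fn k G \<Longrightarrow> primrec_fn k (\<lambda>xs. F xs - G xs)"
proof (rule primrec_fn_app2[where h = "(-)"])
  have "primrec_fn 2 (\<lambda>xs. rec_nat (xs ! 0) (\<lambda>n y. y - 1) (xs ! 1))"
    by (intro primrec_fn_rec primrec_fn_pred primrec_fn.proj) auto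
  moreover have eq: "rec_nat m (\<lambda>n y. y - 1) n = m - n" for n m :: nat by (induction n) auto
  ultimately show "primrec_fn 2 (\<lambda>xs. xs ! 0 - xs ! 1)" by (simp only: eq)
qed

lemma primrec_fn_const: "primrec_fn k (\<lambda>_. c)"
  by (induction c) (auto intro: primrec_fn.zero primrec_fn_Suc)

text \<open>
  Definition by cases is a recursion that is run for at most one round.
\<close>

lemma primrec_fn_if:
  assumes P: "primrec_fn k (\<lambda>xs. of_bool (P xs))" and F: "primrec_fn k F" and G: "primrec_fn k G"
  shows "primrec_fn k (\<lambda>xs. if P xs then F xs else G xs)"
proof -
  let ?C = "\<lambda>xs. rec_nat (xs ! 2) (\<lambda>n y. xs ! 1) (xs ! 0)" and ?B = "\<lambda>xs. of_bool (P xs)"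
  have "primrec_fn (length [?B, F, G]) ?C"
    by (intro primrec_fn_rec primrec_fn_drop2 primrec_fn.proj) auto
  then have "primrec_fn k (\<lambda>xs. ?C (map (\<lambda>G. G xs) [?B, F, G]))"
    by (rule primrec_fn.comp) (use assms in auto)
  then show ?thesis by (rule primrec_fn.cong) simp
qed

lemma primrec_fn_triangle: "primrec_fn k F \<Longrightarrow> primrec_fn k (\<lambda>xs. triangle (F xs))"
proof (rule primrec_fn_app1[where h = triangle])
  have "primrec_fn 1 (\<lambda>xs. rec_nat 0 (\<lambda>n y. y + Suc n) (xs ! 0))"
    by (intro primrec_fn_rec primrec_fn_add primrec_fn_Suc primrec_fn.zero primrec_fn.proj) auto
  moreover have eq: "rec_nat 0 (\<lambda>n y. y + Suc n) n = triangle n" for n by (induction n) auto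
  ultimately show "primrec_fn 1 (\<lambda>xs. triangle (xs ! 0))" by (simp only: eq)
qed

lemma primrec_fn_eq:
  assumes "primrec_fn k F" "primrec_fn k G"
  shows "primrec_fn k (\<lambda>xs. of_bool (F xs = G xs))"
proof -
  have "primrec_fn k (\<lambda>xs. 1 - ((F xs - G xs) + (G xs - F xs)))"
    by (intro primrec_fn_diff primrec_fn_add primrec_fn_const assms)
  moreover have eq: "1 - ((m - n) + (n - m)) = (of_bool (m = n) :: nat)" for m n :: nat by auto
  ultimately show ?thesis by (simp only: eq)
qed

text \<open>
  The pairing function of \<open>Nat_Bijection\<close> enumerates the diagonals of the plane:
  \<open>prod_encode (a, b) = triangle (a + b) + a\<close>.  Decoding therefore needs only the number
  \<open>a + b\<close> of the diagonal, which is computed by recursion on the code because it increases exactly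
  when the code reaches the next triangular number.
\<close>

definition pair :: "nat \<Rightarrow> nat \<Rightarrow> nat" where "pair a b = prod_encode (a, b)"
definition pfst :: "nat \<Rightarrow> nat" where "pfst z = fst (prod_decode z)"
definition psnd :: "nat \<Rightarrow> nat" where "psnd z = snd (prod_decode z)"

lemma pfst_pair [simp]: "pfst (pair a b) = a" and psnd_pair [simp]: "psnd (pair a b) = b"
  by (simp_all add: pair_def pfst_def psnd_def)

lemma pair_pfst_psnd [simp]: "pair (pfst z) (psnd z) = z"
  by (simp add: pair_def pfst_def psnd_def)

lemma pair_eq_iff [simp]: "pair a b = pair c d \<longleftrightarrow> a = c \<and> b = d"
  by (metis pfst_pair psnd_pair)

definition tri_root :: "nat \<Rightarrow> nat" where "tri_root z = pfst z + psnd z"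

lemma triangle_strict_mono: "strict_mono triangle"
  by (rule strict_mono_Suc_iff[THEN iffD2]) simp

lemma tri_root_unique: "triangle k \<le> z \<Longrightarrow> z < triangle (Suc k) \<Longrightarrow> tri_root z = k"
proof -
  assume *: "triangle k \<le> z" "z < triangle (Suc k)"
  define a where "a = z - triangle k"
  have "pair a (k - a) = z" using * by (auto simp: pair_def prod_encode_def a_def)
  moreover have "a \<le> k" using * by (auto simp: a_def)
  ultimately show ?thesis unfolding tri_root_def using pfst_pair psnd_pair by (metis le_add_diff_inverse)
qed

lemma triangle_tri_root: "triangle (tri_root z) + pfst z = z"
  using pair_pfst_psnd[of z] by (simp only: pair_def prod_encode_def case_prod_conv tri_root_def)

lemma tri_root_bounds: "triangle (tri_root z) \<le> z" "z < triangle (Suc (tri_root z))"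
  using triangle_tri_root[of z] by (auto simp: tri_root_def)

lemma tri_root_Suc:
  "tri_root (Suc z) = (if triangle (Suc (tri_root z)) = Suc z then Suc (tri_root z) else tri_root z)"
  using tri_root_bounds[of z] by (auto intro!: tri_root_unique)

lemma primrec_fn_tri_root: "primrec_fn k F \<Longrightarrow> primrec_fn k (\<lambda>xs. tri_root (F xs))"
proof (rule primrec_fn_app1[where h = tri_root])
  have "primrec_fn 1 (\<lambda>xs. rec_nat 0 (\<lambda>z r. if triangle (Suc r) = Suc z then Suc r else r) (xs ! 0))"
    by (intro primrec_fn_rec primrec_fn_if primrec_fn_eq primrec_fn_triangle primrec_fn_Suc
        primrec_fn.zero primrec_fn.proj) auto
  moreover have eq: "rec_nat 0 (\<lambda>z r. if triangle (Suc r) = Suc z then Suc r else r) z = tri_root z" for z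
    by (induction z) (simp_all add: tri_root_Suc tri_root_unique[of 0 0])
  ultimately show "primrec_fn 1 (\<lambda>xs. tri_root (xs ! 0))" by (simp only: eq)
qed

lemma primrec_fn_pfst: "primrec_fn k F \<Longrightarrow> primrec_fn k (\<lambda>xs. pfst (F xs))"
proof (rule primrec_fn_app1[where h = pfst])
  have "primrec_fn 1 (\<lambda>xs. xs ! 0 - triangle (tri_root (xs ! 0)))"
    by (intro primrec_fn_diff primrec_fn_triangle primrec_fn_tri_root primrec_fn.proj) auto
  moreover have eq: "z - triangle (tri_root z) = pfst z" for z
    using triangle_tri_root[of z] by simp
  ultimately show "primrec_fn 1 (\<lambda>xs. pfst (xs ! 0))" by (simp only: eq)
qed

lemma primrec_fn_psnd: "primrec_fn k F \<Longrightarrow> primrec_fn k (\<lambda>xs. psnd (F xs))"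
proof (rule primrec_fn_app1[where h = psnd])
  have "primrec_fn 1 (\<lambda>xs. tri_root (xs ! 0) - pfst (xs ! 0))"
    by (intro primrec_fn_diff primrec_fn_pfst primrec_fn_tri_root primrec_fn.proj) auto
  then show "primrec_fn 1 (\<lambda>xs. psnd (xs ! 0))" by (simp add: tri_root_def)
qed

lemma primrec_fn_pair: "primrec_fn k F \<Longrightarrow> primrec_fn k G \<Longrightarrow> primrec_fn k (\<lambda>xs. pair (F xs) (G xs))"
proof (rule primrec_fn_app2[where h = pair])
  have "primrec_fn 2 (\<lambda>xs. triangle (xs ! 0 + xs ! 1) + xs ! 0)"
    by (intro primrec_fn_add primrec_fn_triangle primrec_fn.proj) auto
  then show "primrec_fn 2 (\<lambda>xs. pair (xs ! 0) (xs ! 1))" by (simp add: pair_def prod_encode_def)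
qed

text \<open>
  With pairing available, all functions can be taken unary: the argument is an environment, a
  nested pair of the values of the variables in scope.  A binder extends the environment on the left,
  so a rule for a binder has a premise about \<open>\<lambda>z. P (pfst z) (psnd z)\<close>.  This is a higher-order
  pattern, so that enumerability of a concrete formula is proved by \<open>intro\<close> alone.
\<close>

definition PR :: "(nat \<Rightarrow> nat) \<Rightarrow> bool" where "PR f \<longleftrightarrow> primrec_fn 1 (\<lambda>xs. f (xs ! 0))"

lemma PR_compose: "PR h \<Longrightarrow> PR F \<Longrightarrow> PR (\<lambda>e. h (F e))"
  unfolding PR_def by (rule primrec_fn_app1)

lemma PR_id: "PR (\<lambda>e. e)" unfolding PR_def by (rule primrec_fn.proj) simp
lemma PR_const: "PR (\<lambda>e. c)" unfolding PR_def by (rule primrec_fn_const)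
lemma PR_Suc: "PR F \<Longrightarrow> PR (\<lambda>e. Suc (F e))" unfolding PR_def by (rule primrec_fn_Suc)
lemma PR_add: "PR F \<Longrightarrow> PR G \<Longrightarrow> PR (\<lambda>e. F e + G e)" unfolding PR_def by (rule primrec_fn_add)
lemma PR_diff: "PR F \<Longrightarrow> PR G \<Longrightarrow> PR (\<lambda>e. F e - G e)" unfolding PR_def by (rule primrec_fn_diff)
lemma PR_pair: "PR F \<Longrightarrow> PR G \<Longrightarrow> PR (\<lambda>e. pair (F e) (G e))" unfolding PR_def by (rule primrec_fn_pair)
lemma PR_pfst: "PR F \<Longrightarrow> PR (\<lambda>e. pfst (F e))" unfolding PR_def by (rule primrec_fn_pfst)
lemma PR_psnd: "PR F \<Longrightarrow> PR (\<lambda>e. psnd (F e))" unfolding PR_def by (rule primrec_fn_psnd)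

lemma PR_rec:
  assumes "PR A" "PR N" and S: "PR (\<lambda>z. S (pfst z) (pfst (psnd z)) (psnd (psnd z)))"
  shows "PR (\<lambda>e. rec_nat (A e) (\<lambda>n y. S n y e) (N e))"
  unfolding PR_def
proof (rule primrec_fn_rec)
  have "primrec_fn 3 (\<lambda>ys. pair (ys ! 0) (pair (ys ! 1) (ys ! 2)))"
    by (intro primrec_fn_pair primrec_fn.proj) auto
  from primrec_fn_app1[OF S[unfolded PR_def] this]
  show "primrec_fn (Suc (Suc 1)) (\<lambda>ys. S (ys ! 0) (ys ! 1) (drop 2 ys ! 0))"
    by (simp add: numeral_3_eq_3) (erule primrec_fn.cong, auto simp: numeral_2_eq_2)
qed (use assms PR_def in auto)

definition PRP :: "(nat \<Rightarrow> bool) \<Rightarrow> bool" where "PRP P \<longleftrightarrow> PR (\<lambda>e. of_bool (P e))"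

lemma PR_if: "PRP P \<Longrightarrow> PR F \<Longrightarrow> PR G \<Longrightarrow> PR (\<lambda>e. if P e then F e else G e)"
  unfolding PR_def PRP_def by (rule primrec_fn_if)

lemma PRP_subst: "PRP P \<Longrightarrow> PR F \<Longrightarrow> PRP (\<lambda>e. P (F e))"
  unfolding PRP_def by (rule PR_compose)

lemma PRP_eq: "PR F \<Longrightarrow> PR G \<Longrightarrow> PRP (\<lambda>e. F e = G e)"
  unfolding PR_def PRP_def by (rule primrec_fn_eq)

lemma PRP_conj: assumes "PRP P" "PRP Q" shows "PRP (\<lambda>e. P e \<and> Q e)"
proof -
  have "PR (\<lambda>e. if P e then of_bool (Q e) else 0)"
    using assms by (intro PR_if PR_const) (simp_all add: PRP_def)
  moreover have eq: "(if P e then of_bool (Q e) else 0) = (of_bool (P e \<and> Q e) :: nat)" for e by simp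
  ultimately show ?thesis unfolding PRP_def by (simp only: eq)
qed

lemma PRP_not: assumes "PRP P" shows "PRP (\<lambda>e. \<not> P e)"
proof -
  have "PR (\<lambda>e. if P e then 0 else 1)" using assms by (intro PR_if PR_const)
  moreover have eq: "(if P e then 0 else 1) = (of_bool (\<not> P e) :: nat)" for e by simp
  ultimately show ?thesis unfolding PRP_def by (simp only: eq)
qed

lemma PRP_disj: "PRP P \<Longrightarrow> PRP Q \<Longrightarrow> PRP (\<lambda>e. P e \<or> Q e)"
  using PRP_not[OF PRP_conj[OF PRP_not[of P] PRP_not[of Q]]] by simp

lemma PRP_bex:
  assumes "PR N" "PRP (\<lambda>z. P (pfst z) (psnd z))"
  shows "PRP (\<lambda>e. \<exists>i<N e. P i e)"
proof -
  have "PRP (\<lambda>z. P (pfst z) (psnd (psnd z)))"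
    using PRP_subst[OF assms(2), of "\<lambda>z. pair (pfst z) (psnd (psnd z))"]
    by (simp add: PR_pair PR_pfst PR_psnd PR_id)
  then have "PR (\<lambda>e. rec_nat 0 (\<lambda>i y. if P i e then 1 else y) (N e))"
    by (intro PR_rec PR_if PR_const PR_pfst PR_psnd PR_id assms)
  moreover have eq: "rec_nat 0 (\<lambda>i y. if P i e then 1 else y) n = (of_bool (\<exists>i<n. P i e) :: nat)" for n e
    by (induction n) (auto simp: less_Suc_eq)
  ultimately show ?thesis unfolding PRP_def by (simp only: eq)
qed

lemma PRP_ball:
  assumes "PR N" "PRP (\<lambda>z. P (pfst z) (psnd z))"
  shows "PRP (\<lambda>e. \<forall>i<N e. P i e)"
  using PRP_not[OF PRP_bex[OF assms(1) PRP_not[OF assms(2)]]] by simp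

lemma PRP_finite: "finite S \<Longrightarrow> PR F \<Longrightarrow> PRP (\<lambda>e. F e \<in> S)"
proof (induction rule: finite_induct)
  case empty
  then show ?case unfolding PRP_def using PR_const[of 0] by simp
next
  case (insert x S)
  then show ?case by (simp add: PRP_disj PRP_eq PR_const)
qed

lemmas PR_intros = PRP_conj PRP_disj PRP_not PRP_eq PRP_bex PRP_ball
  PR_id PR_const PR_Suc PR_add PR_diff PR_pair PR_pfst PR_psnd PR_if

section \<open>Recursively enumerable predicates\<close>

text \<open>
  For projections of primitive recursive predicates, closure under the positive connectives and bounded
  quantifiers is a matter of pairing witnesses.  That halting of Kleene schemes defines the same class is
  proved by search in one direction and by coded derivations in the other.
\<close>

definition RE :: "(nat \<Rightarrow> bool) \<Rightarrow> bool" where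
  "RE P \<longleftrightarrow> (\<exists>R. PRP (\<lambda>z. R (pfst z) (psnd z)) \<and> (\<forall>e. P e \<longleftrightarrow> (\<exists>t. R t e)))"

lemma REI: "PRP (\<lambda>z. R (pfst z) (psnd z)) \<Longrightarrow> (\<And>e. P e \<longleftrightarrow> (\<exists>t. R t e)) \<Longrightarrow> RE P"
  unfolding RE_def by blast

lemma RE_PRP: "PRP P \<Longrightarrow> RE P"
  by (rule REI[of "\<lambda>t. P"]) (auto intro: PRP_subst[OF _ PR_psnd[OF PR_id]])

lemma RE_subst:
  assumes "RE P" "PR F" shows "RE (\<lambda>e. P (F e))"
proof -
  obtain R where R: "PRP (\<lambda>z. R (pfst z) (psnd z))" "\<And>e. P e \<longleftrightarrow> (\<exists>t. R t e)"
    using assms(1) unfolding RE_def by blast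
  have "PRP (\<lambda>z. R (pfst z) (F (psnd z)))"
    using PRP_subst[OF R(1), of "\<lambda>z. pair (pfst z) (F (psnd z))"]
    by (simp add: PR_intros PR_compose[OF assms(2)])
  then show ?thesis using R(2) by (intro REI) auto
qed

lemma RE_ex:
  assumes "RE (\<lambda>z. P (pfst z) (psnd z))" shows "RE (\<lambda>e. \<exists>i. P i e)"
proof -
  obtain R where R: "PRP (\<lambda>z. R (pfst z) (psnd z))" "\<And>z. P (pfst z) (psnd z) \<longleftrightarrow> (\<exists>t. R t z)"
    using assms unfolding RE_def by blast
  \<comment> \<open>The new witness is a pair: the old witness together with the quantified number.\<close>
  have "PRP (\<lambda>z. R (pfst (pfst z)) (pair (psnd (pfst z)) (psnd z)))"
    using PRP_subst[OF R(1), of "\<lambda>z. pair (pfst (pfst z)) (pair (psnd (pfst z)) (psnd z))"]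
    by (simp add: PR_intros)
  moreover have "(\<exists>i. P i e) \<longleftrightarrow> (\<exists>t. R (pfst t) (pair (psnd t) e))" for e
    using R(2)[of "pair i e" for i] by simp (metis pfst_pair psnd_pair)
  ultimately show ?thesis by (intro REI[of "\<lambda>t e. R (pfst t) (pair (psnd t) e)"]) auto
qed

lemma RE_conj:
  assumes "RE P" "RE Q" shows "RE (\<lambda>e. P e \<and> Q e)"
proof -
  obtain R where R: "PRP (\<lambda>z. R (pfst z) (psnd z))" "\<And>z. P z \<longleftrightarrow> (\<exists>t. R t z)"
    using assms(1) unfolding RE_def by blast
  obtain S where S: "PRP (\<lambda>z. S (pfst z) (psnd z))" "\<And>z. Q z \<longleftrightarrow> (\<exists>t. S t z)"
    using assms(2) unfolding RE_def by blast
  have "PRP (\<lambda>z. R (pfst (pfst z)) (psnd z) \<and> S (psnd (pfst z)) (psnd z))"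
    using PRP_subst[OF R(1), of "\<lambda>z. pair (pfst (pfst z)) (psnd z)"]
      PRP_subst[OF S(1), of "\<lambda>z. pair (psnd (pfst z)) (psnd z)"]
    by (simp add: PR_intros)
  moreover have "P e \<and> Q e \<longleftrightarrow> (\<exists>t. R (pfst t) e \<and> S (psnd t) e)" for e
    unfolding R(2) S(2) by (metis pfst_pair psnd_pair)
  ultimately show ?thesis by (intro REI[of "\<lambda>t e. R (pfst t) e \<and> S (psnd t) e"])
qed

lemma RE_disj:
  assumes "RE P" "RE Q" shows "RE (\<lambda>e. P e \<or> Q e)"
proof -
  obtain R where R: "PRP (\<lambda>z. R (pfst z) (psnd z))" "\<And>z. P z \<longleftrightarrow> (\<exists>t. R t z)"
    using assms(1) unfolding RE_def by blast
  obtain S where S: "PRP (\<lambda>z. S (pfst z) (psnd z))" "\<And>z. Q z \<longleftrightarrow> (\<exists>t. S t z)"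
    using assms(2) unfolding RE_def by blast
  show ?thesis
    using R S by (intro REI[of "\<lambda>t e. R t e \<or> S t e"]) (auto intro: PRP_disj)
qed

text \<open>
  Finitely many witnesses have a common bound, so a bounded universal quantifier is absorbed by
  one existential quantifier over that bound.
\<close>

lemma RE_ball:
  assumes "PR N" "RE (\<lambda>z. P (pfst z) (psnd z))"
  shows "RE (\<lambda>e. \<forall>i<N e. P i e)"
proof -
  obtain R where R: "PRP (\<lambda>z. R (pfst z) (psnd z))" "\<And>z. P (pfst z) (psnd z) \<longleftrightarrow> (\<exists>t. R t z)"
    using assms unfolding RE_def by blast
  have "PRP (\<lambda>z. R (pfst z) (pair (pfst (psnd z)) (psnd (psnd (psnd z)))))"
    using PRP_subst[OF R(1), of "\<lambda>z. pair (pfst z) (pair (pfst (psnd z)) (psnd (psnd (psnd z))))"]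
    by (simp add: PR_intros)
  then have "PRP (\<lambda>z. \<forall>i<N (psnd z). \<exists>t<pfst z. R t (pair i (psnd z)))"
    by (intro PRP_ball PRP_bex PR_compose[OF assms(1)] PR_intros)
  moreover have "(\<forall>i<n. P i e) \<longleftrightarrow> (\<exists>T. \<forall>i<n. \<exists>t<T. R t (pair i e))" for e n
  proof
    assume "\<forall>i<n. P i e"
    then have "\<forall>i<n. \<exists>t. R t (pair i e)" using R(2)[of "pair i e" for i] by simp
    then obtain t where t: "\<And>i. i < n \<Longrightarrow> R (t i) (pair i e)" by metis
    have "t i < Suc (\<Sum>i<n. t i)" if "i < n" for i
      using that by (intro le_imp_less_Suc member_le_sum) auto
    then show "\<exists>T. \<forall>i<n. \<exists>t<T. R t (pair i e)" using t by blast
  next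
    assume "\<exists>T. \<forall>i<n. \<exists>t<T. R t (pair i e)"
    then show "\<forall>i<n. P i e" using R(2)[of "pair i e" for i] by simp blast
  qed
  ultimately show ?thesis by (intro REI) auto
qed

text \<open>
  Unbounded search for a witness is a single application of \<open>Mu\<close> to a total function.
\<close>

lemma RE_recursively_enumerable:
  assumes "RE P" shows "recursively_enumerable {n. P n}"
proof -
  obtain R where R: "PRP (\<lambda>z. R (pfst z) (psnd z))" "\<And>e. P e \<longleftrightarrow> (\<exists>t. R t e)"
    using assms unfolding RE_def by blast
  have "PR (\<lambda>z. of_bool (\<not> R (pfst z) (psnd z)))" using PRP_not[OF R(1)] unfolding PRP_def .
  from primrec_fn_app1[OF this[unfolded PR_def] primrec_fn_pair[OF primrec_fn.proj[of 0 2] primrec_fn.proj[of 1 2]]]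
  have "primrec_fn 2 (\<lambda>xs. of_bool (\<not> R (xs ! 0) (xs ! 1)))" by simp
  then obtain g where g: "\<And>xs. length xs = 2 \<Longrightarrow> computes g xs (of_bool (\<not> R (xs ! 0) (xs ! 1)))"
    using primrec_fn_computes by blast
  have g': "computes g [t, n] y \<longleftrightarrow> y = of_bool (\<not> R t n)" for t n y
    using g[of "[t, n]"] computes_deterministic by auto
  have "(\<exists>t. R t n) \<longleftrightarrow> (\<exists>y. computes (Mu g) [n] y)" for n
  proof
    assume "\<exists>t. R t n"
    then have "R (LEAST t. R t n) n" by (rule LeastI_ex)
    then show "\<exists>y. computes (Mu g) [n] y"
      by (intro exI[of _ "LEAST t. R t n"] computes.mu) (auto simp: g' dest: not_less_Least)
  next
    assume "\<exists>y. computes (Mu g) [n] y"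
    then show "\<exists>t. R t n" by (auto elim!: computes.cases[of "Mu g"] simp: g' split: if_splits)
  qed
  then show ?thesis unfolding recursively_enumerable_def R(2) by blast
qed

lemmas RE_intros = RE_conj RE_disj RE_ex RE_ball

lemma PRP_subst2: "PRP (\<lambda>z. P (pfst z) (psnd z)) \<Longrightarrow> PR F \<Longrightarrow> PR G \<Longrightarrow> PRP (\<lambda>e. P (F e) (G e))"
  using PRP_subst[of "\<lambda>z. P (pfst z) (psnd z)" "\<lambda>e. pair (F e) (G e)"] by (simp add: PR_pair)

lemma RE_subst2: "RE (\<lambda>z. P (pfst z) (psnd z)) \<Longrightarrow> PR F \<Longrightarrow> PR G \<Longrightarrow> RE (\<lambda>e. P (F e) (G e))"
  using RE_subst[of "\<lambda>z. P (pfst z) (psnd z)" "\<lambda>e. pair (F e) (G e)"] by (simp add: PR_pair)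

lemma RE_eq: "PR F \<Longrightarrow> PR G \<Longrightarrow> RE (\<lambda>e. F e = G e)"
  by (intro RE_PRP PRP_eq)

lemma RE_neq: "PR F \<Longrightarrow> PR G \<Longrightarrow> RE (\<lambda>e. F e \<noteq> G e)"
  by (intro RE_PRP PRP_not PRP_eq)

section \<open>A universal enumerable predicate\<close>

text \<open>
  Operations on codes of lists, primitive recursive counterparts of those on lists.  The tail of
  the code \<open>0\<close> of the empty list is again \<open>0\<close>, so \<open>cdrop\<close> tests the length of a list.
\<close>

definition ccons :: "nat \<Rightarrow> nat \<Rightarrow> nat" where "ccons h t = Suc (pair h t)"
definition cdrop :: "nat \<Rightarrow> nat \<Rightarrow> nat" where "cdrop n c = rec_nat c (\<lambda>_ y. psnd (y - 1)) n"
definition cnth :: "nat \<Rightarrow> nat \<Rightarrow> nat" where "cnth n c = pfst (cdrop n c - 1)"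

lemma list_encode_Cons: "list_encode (x # xs) = ccons x (list_encode xs)"
  by (simp add: ccons_def pair_def)

(* Codes of nonempty lists are kept in the form given by list_encode_Cons. *)
declare list_encode.simps(2) [simp del]

lemma list_encode_eq_ccons:
  "list_encode xs = ccons x l \<longleftrightarrow> xs = x # list_decode l"
  by (metis list_encode_Cons list_decode_inverse list_encode_inverse)

lemma list_encode_eq_0 [simp]: "list_encode xs = 0 \<longleftrightarrow> xs = []"
  by (cases xs) (auto simp: list_encode_Cons ccons_def)

lemma list_encode_pos [simp]: "0 < list_encode xs \<longleftrightarrow> xs \<noteq> []"
  by (simp add: neq0_conv[symmetric] del: neq0_conv)

lemma cdrop_list_encode [simp]: "cdrop n (list_encode xs) = list_encode (drop n xs)"
proof (induction n)
  case (Suc n)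
  have "psnd 0 = 0" using psnd_pair[of 0 0] by (simp add: pair_def prod_encode_def)
  then have "psnd (list_encode ys - 1) = list_encode (tl ys)" for ys
    by (cases ys) (simp_all add: list_encode_Cons ccons_def)
  then show ?case using Suc by (simp add: cdrop_def drop_Suc tl_drop)
qed (simp add: cdrop_def)

lemma cnth_list_encode [simp]: "n < length xs \<Longrightarrow> cnth n (list_encode xs) = xs ! n"
  by (simp add: cnth_def Cons_nth_drop_Suc[symmetric] list_encode_Cons ccons_def)

lemma length_le_list_encode: "length xs \<le> list_encode xs"
proof (induction xs)
  case (Cons x xs)
  then show ?case using le_prod_encode_2[of "list_encode xs" x] by (simp add: list_encode.simps)
qed simp

lemma PR_ccons: "PR F \<Longrightarrow> PR G \<Longrightarrow> PR (\<lambda>e. ccons (F e) (G e))"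
  unfolding ccons_def by (intro PR_intros)

lemma PR_cdrop: "PR F \<Longrightarrow> PR G \<Longrightarrow> PR (\<lambda>e. cdrop (F e) (G e))"
  unfolding cdrop_def by (intro PR_rec PR_intros)

lemma PR_cnth: "PR F \<Longrightarrow> PR G \<Longrightarrow> PR (\<lambda>e. cnth (F e) (G e))"
  unfolding cnth_def by (intro PR_intros PR_cdrop)

definition cmem :: "nat \<Rightarrow> nat \<Rightarrow> bool" where "cmem t c \<longleftrightarrow> (\<exists>j. cdrop j c \<noteq> 0 \<and> cnth j c = t)"

lemma cmem_list_encode [simp]: "cmem t (list_encode xs) \<longleftrightarrow> t \<in> set xs"
  by (auto simp: cmem_def in_set_conv_nth) (metis cnth_list_encode not_le)+

lemma RE_cmem: "PR F \<Longrightarrow> PR G \<Longrightarrow> RE (\<lambda>e. cmem (F e) (G e))"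
  unfolding cmem_def
  by (rule RE_subst2) (intro RE_ex RE_conj RE_eq RE_neq PR_cdrop PR_cnth PR_intros)+

primrec recf_code :: "recf \<Rightarrow> nat" where
  "recf_code Zero = pair 0 0"
| "recf_code Succ = pair 1 0"
| "recf_code (Proj i) = pair 2 i"
| "recf_code (Comp f gs) = pair 3 (pair (recf_code f) (list_encode (map recf_code gs)))"
| "recf_code (PrimRec f g) = pair 4 (pair (recf_code f) (recf_code g))"
| "recf_code (Mu f) = pair 5 (recf_code f)"

definition fact_code :: "nat \<Rightarrow> nat \<Rightarrow> nat \<Rightarrow> nat" where
  "fact_code e xs y = pair e (pair xs y)"

lemma fact_code_eq [simp]: "fact_code e xs y = fact_code e' xs' y' \<longleftrightarrow> e = e' \<and> xs = xs' \<and> y = y'"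
  by (simp add: fact_code_def)

lemma PR_fact_code: "PR F \<Longrightarrow> PR G \<Longrightarrow> PR H \<Longrightarrow> PR (\<lambda>e. fact_code (F e) (G e) (H e))"
  unfolding fact_code_def by (intro PR_intros)

text \<open>
  A derivation of \<open>computes f xs y\<close> is a finite list of coded facts in which every fact follows by one
  of the rules of \<^const>\<open>computes\<close> from facts later in the list.  \<open>justified t M\<close> is the rule check for
  the fact \<open>t\<close> when \<open>M\<close> is the set of facts already derived; its disjuncts are the rules
  \<open>zero\<close>, \<open>succ\<close>, \<open>proj\<close>, \<open>comp\<close>, \<open>rec_zero\<close>, \<open>rec_suc\<close> and \<open>mu\<close>.  Only \<open>M\<close> occurs, never its
  complement, and so the check is both monotone and enumerable.
\<close>

definition justified :: "nat \<Rightarrow> (nat \<Rightarrow> bool) \<Rightarrow> bool" where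
  "justified t M \<longleftrightarrow>
    (\<exists>xs. t = fact_code (pair 0 0) xs 0) \<or>
    (\<exists>x xs. t = fact_code (pair 1 0) (ccons x xs) (Suc x)) \<or>
    (\<exists>i xs. t = fact_code (pair 2 i) xs (cnth i xs) \<and> cdrop i xs \<noteq> 0) \<or>
    (\<exists>f gs xs y ys n. t = fact_code (pair 3 (pair f gs)) xs y \<and> cdrop n gs = 0 \<and> cdrop n ys = 0 \<and>
       (\<forall>i<n. cdrop i gs \<noteq> 0 \<and> cdrop i ys \<noteq> 0 \<and> M (fact_code (cnth i gs) xs (cnth i ys))) \<and>
       M (fact_code f ys y)) \<or>
    (\<exists>f g xs y. t = fact_code (pair 4 (pair f g)) (ccons 0 xs) y \<and> M (fact_code f xs y)) \<or>
    (\<exists>f g n xs y z. t = fact_code (pair 4 (pair f g)) (ccons (Suc n) xs) z \<and>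
       M (fact_code (pair 4 (pair f g)) (ccons n xs) y) \<and>
       M (fact_code g (ccons n (ccons y xs)) z)) \<or>
    (\<exists>f xs n. t = fact_code (pair 5 f) xs n \<and> M (fact_code f (ccons n xs) 0) \<and>
       (\<forall>m<n. \<exists>y. M (fact_code f (ccons m xs) (Suc y))))"

lemma justified_mono: "justified t M \<Longrightarrow> (\<And>u. M u \<Longrightarrow> M' u) \<Longrightarrow> justified t M'"
  unfolding justified_def by (elim disj_forward ex_forward conj_forward all_forward imp_forward) blast+

lemma RE_justified: "RE (\<lambda>z. justified (pfst z) (\<lambda>t. cmem t (psnd z)))"
  unfolding justified_def
  by (intro RE_intros RE_eq RE_neq RE_cmem PR_fact_code PR_ccons PR_cdrop PR_cnth
      PR_id PR_const PR_Suc PR_pair PR_pfst PR_psnd)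

definition derivation :: "nat \<Rightarrow> bool" where
  "derivation c \<longleftrightarrow> (\<forall>k<c. cdrop k c = 0 \<or> justified (cnth k c) (\<lambda>t. cmem t (cdrop (Suc k) c)))"

lemma RE_derivation: "PR F \<Longrightarrow> RE (\<lambda>e. derivation (F e))"
proof -
  have "RE (\<lambda>c. derivation c)"
    unfolding derivation_def
    by (intro RE_ball RE_disj RE_eq RE_subst2[OF RE_justified] PR_cdrop PR_cnth
      PR_id PR_const PR_Suc PR_pair PR_pfst PR_psnd)
  then show "PR F \<Longrightarrow> RE (\<lambda>e. derivation (F e))" by (rule RE_subst)
qed

primrec derivation_list :: "nat list \<Rightarrow> bool" where
  "derivation_list [] = True"
| "derivation_list (t # L) = (justified t (\<lambda>u. u \<in> set L) \<and> derivation_list L)"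

lemma derivation_list_iff:
  "derivation_list L \<longleftrightarrow> (\<forall>k<length L. justified (L ! k) (\<lambda>u. u \<in> set (drop (Suc k) L)))"
  by (induction L) (auto simp: less_Suc_eq_0_disj)

lemma derivation_list_encode: "derivation (list_encode L) \<longleftrightarrow> derivation_list L"
proof -
  have "derivation (list_encode L) \<longleftrightarrow>
      (\<forall>k<list_encode L. k < length L \<longrightarrow> justified (L ! k) (\<lambda>u. u \<in> set (drop (Suc k) L)))"
    unfolding derivation_def by (auto simp: not_le) (metis cnth_list_encode not_le)
  then show ?thesis unfolding derivation_list_iff
    using length_le_list_encode[of L] by (meson less_le_trans)
qed

lemma derivation_list_append:
  "derivation_list L \<Longrightarrow> derivation_list L' \<Longrightarrow> derivation_list (L @ L')"
  by (induction L) (auto elim: justified_mono)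

text \<open>
  The rules \<open>comp\<close> and \<open>mu\<close> have finitely many premises; their derivations are concatenated.
\<close>

lemma derivation_list_collect:
  fixes n :: nat
  shows "\<forall>i<n. \<exists>L. derivation_list L \<and> a i \<in> set L \<Longrightarrow> \<exists>L. derivation_list L \<and> (\<forall>i<n. a i \<in> set L)"
proof (induction n)
  case 0
  show ?case by (rule exI[of _ "[]"]) simp
next
  case (Suc n)
  then obtain L L' where "derivation_list L" "\<forall>i<n. a i \<in> set L" "derivation_list L'" "a n \<in> set L'"
    by (meson lessI less_SucI)
  then show ?case
    by (intro exI[of _ "L @ L'"]) (auto simp: less_Suc_eq derivation_list_append)
qed

abbreviation computes_code :: "recf \<Rightarrow> nat list \<Rightarrow> nat \<Rightarrow> nat" where
  "computes_code f xs y \<equiv> fact_code (recf_code f) (list_encode xs) y"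

text \<open>
  The code of a scheme determines its constructor and the codes of its parts, so the disjunct
  that justifies a fact about \<open>f\<close> is the rule for the constructor of \<open>f\<close>.
\<close>

lemma justified_sound:
  assumes "justified (computes_code f xs y) M"
    and M: "\<And>g ys z. M (computes_code g ys z) \<Longrightarrow> computes g ys z"
  shows "computes f xs y"
proof (cases f)
  case Zero
  then show ?thesis using assms(1) by (auto simp: justified_def intro: computes.zero)
next
  case Succ
  then show ?thesis using assms(1)
    by (auto simp: justified_def list_encode_eq_ccons intro: computes.succ)
next
  case (Proj i)
  then show ?thesis using assms(1) by (auto simp: justified_def not_le intro: computes.proj)
next
  case (Comp g gs)
  then obtain ys n where ys: "cdrop n (list_encode (map recf_code gs)) = 0" "cdrop n ys = 0"
    "\<And>i. i < n \<Longrightarrow> cdrop i (list_encode (map recf_code gs)) \<noteq> 0 \<and> cdrop i ys \<noteq> 0 \<and>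
      M (fact_code (cnth i (list_encode (map recf_code gs))) (list_encode xs) (cnth i ys))"
    "M (fact_code (recf_code g) ys y)"
    using assms(1) unfolding justified_def by auto
  define zs where "zs = list_decode ys"
  have [simp]: "ys = list_encode zs" by (simp add: zs_def)
  have n: "length gs \<le> n" "length zs \<le> n" using ys(1,2) by auto
  have n': "i < length gs \<and> i < length zs" if "i < n" for i using ys(3)[OF that] by (auto simp: not_le)
  have len: "length gs = n" "length zs = n"
    using n n'[of "length gs"] n'[of "length zs"] by (auto simp: le_less)
  have "computes (gs ! i) xs (zs ! i)" if "i < n" for i
    using ys(3)[OF that] that len by (intro M) simp
  moreover have "computes g zs y" using ys(4) by (intro M) simp
  ultimately show ?thesis using len unfolding Comp by (intro computes.comp[of zs]) auto
next
  case (PrimRec g h)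
  then consider (z) l where "list_encode xs = ccons 0 l" "M (fact_code (recf_code g) l y)"
    | (s) n l z where "list_encode xs = ccons (Suc n) l"
        "M (fact_code (recf_code (PrimRec g h)) (ccons n l) z)"
        "M (fact_code (recf_code h) (ccons n (ccons z l)) y)"
    using assms(1) unfolding justified_def by auto
  then show ?thesis
  proof cases
    case z
    then have "computes g (list_decode l) y" by (intro M) simp
    then show ?thesis using z PrimRec by (auto simp: list_encode_eq_ccons intro: computes.rec_zero)
  next
    case s
    have "computes (PrimRec g h) (n # list_decode l) z" using s(2)
      by (intro M) (simp add: list_encode_Cons)
    moreover have "computes h (n # z # list_decode l) y" using s(3)
      by (intro M) (simp add: list_encode_Cons)
    ultimately show ?thesis using s(1) PrimRec
      by (auto simp: list_encode_eq_ccons intro: computes.rec_suc)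
  qed
next
  case (Mu g)
  then have *: "M (fact_code (recf_code g) (ccons y (list_encode xs)) 0)"
    "\<forall>m<y. \<exists>z. M (fact_code (recf_code g) (ccons m (list_encode xs)) (Suc z))"
    using assms(1) unfolding justified_def by auto
  then have "computes g (y # xs) 0" "\<forall>m<y. \<exists>z. computes g (m # xs) (Suc z)"
    using M unfolding list_encode_Cons[symmetric] by blast+
  then show ?thesis unfolding Mu by (intro computes.mu) auto
qed

lemma derivation_list_sound:
  "derivation_list L \<Longrightarrow> computes_code f xs y \<in> set L \<Longrightarrow> computes f xs y"
proof (induction L arbitrary: f xs y)
  case (Cons t L)
  then show ?case using justified_sound[of f xs y "\<lambda>u. u \<in> set L"] by auto
qed simp

lemma derivation_list_complete:
  "computes f xs y \<Longrightarrow> \<exists>L. derivation_list L \<and> computes_code f xs y \<in> set L"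
proof (induction rule: computes.induct)
  case (zero xs)
  show ?case by (rule exI[of _ "[computes_code Zero xs 0]"]) (simp add: justified_def)
next
  case (succ x xs)
  show ?case
    by (rule exI[of _ "[computes_code Succ (x # xs) (Suc x)]"])
      (auto simp: justified_def list_encode_Cons)
next
  case (proj i xs)
  then show ?case
    by (intro exI[of _ "[computes_code (Proj i) xs (xs ! i)]"]) (auto simp: justified_def)
next
  case (comp ys gs xs f z)
  have "\<forall>i<length gs. \<exists>L. derivation_list L \<and> computes_code (gs ! i) xs (ys ! i) \<in> set L"
    using comp by blast
  from derivation_list_collect[OF this] obtain L where L: "derivation_list L"
    "\<And>i. i < length gs \<Longrightarrow> computes_code (gs ! i) xs (ys ! i) \<in> set L" by blast
  obtain L' where L': "derivation_list L'" "computes_code f ys z \<in> set L'" using comp by blast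
  have "justified (computes_code (Comp f gs) xs z) (\<lambda>u. u \<in> set (L @ L'))"
    unfolding justified_def using comp(1) L(2) L'(2)
    by (intro disjI2 disjI1, simp, intro exI[of _ "list_encode ys"] exI[of _ "length gs"]) auto
  then show ?case using L(1) L'(1)
    by (intro exI[of _ "computes_code (Comp f gs) xs z # L @ L'"])
      (simp add: derivation_list_append del: recf_code.simps)
next
  case (rec_zero f xs y g)
  then obtain L where L: "derivation_list L" "computes_code f xs y \<in> set L" by blast
  then show ?case
    by (intro exI[of _ "computes_code (PrimRec f g) (0 # xs) y # L"])
      (auto simp: justified_def list_encode_Cons)
next
  case (rec_suc f g n xs y z)
  then obtain L L' where L: "derivation_list L" "computes_code (PrimRec f g) (n # xs) y \<in> set L"
    and L': "derivation_list L'" "computes_code g (n # y # xs) z \<in> set L'" by blast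
  have "justified (computes_code (PrimRec f g) (Suc n # xs) z) (\<lambda>u. u \<in> set (L @ L'))"
    unfolding justified_def using L(2) L'(2)
    by (auto simp: list_encode_Cons)
  then show ?case using L(1) L'(1)
    by (intro exI[of _ "computes_code (PrimRec f g) (Suc n # xs) z # L @ L'"])
      (simp add: derivation_list_append del: recf_code.simps)
next
  case (mu f n xs)
  then have "\<forall>m. \<exists>y. m < n \<longrightarrow> y > 0 \<and> (\<exists>L. derivation_list L \<and> computes_code f (m # xs) y \<in> set L)"
    by blast
  then obtain y where y: "\<And>m. m < n \<Longrightarrow> y m > 0"
    and "\<forall>m<n. \<exists>L. derivation_list L \<and> computes_code f (m # xs) (y m) \<in> set L" by metis
  from derivation_list_collect[OF this(2)] obtain L where L: "derivation_list L"
    "\<And>m. m < n \<Longrightarrow> computes_code f (m # xs) (y m) \<in> set L" by blast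
  obtain L' where L': "derivation_list L'" "computes_code f (n # xs) 0 \<in> set L'" using mu by blast
  have "\<forall>m<n. \<exists>y. computes_code f (m # xs) (Suc y) \<in> set (L @ L')"
    using L(2) y by (metis Suc_pred' Un_iff set_append)
  then have "justified (computes_code (Mu f) xs n) (\<lambda>u. u \<in> set (L @ L'))"
    unfolding justified_def using L'(2)
    by (auto simp: list_encode_Cons)
  then show ?case using L(1) L'(1)
    by (intro exI[of _ "computes_code (Mu f) xs n # L @ L'"])
      (simp add: derivation_list_append del: recf_code.simps)
qed

text \<open>
  Existence of a derivation is an enumerable condition on code and argument together.  Thus
  \<open>accepts\<close> is universal for the enumerable sets, and every recursively enumerable set is the
  projection of a primitive recursive predicate.
\<close>

definition accepts :: "nat \<Rightarrow> nat \<Rightarrow> bool" where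
  "accepts e x \<longleftrightarrow> (\<exists>c y. derivation c \<and> cmem (fact_code e (list_encode [x]) y) c)"

lemma accepts_recf_code: "accepts (recf_code f) x \<longleftrightarrow> (\<exists>y. computes f [x] y)"
proof
  assume "accepts (recf_code f) x"
  then obtain c y where "derivation c" "cmem (computes_code f [x] y) c"
    unfolding accepts_def by blast
  then have "derivation_list (list_decode c)" "computes_code f [x] y \<in> set (list_decode c)"
    by (metis derivation_list_encode cmem_list_encode list_decode_inverse)+
  then show "\<exists>y. computes f [x] y" using derivation_list_sound by blast
next
  assume "\<exists>y. computes f [x] y"
  then obtain y L where "derivation_list L" "computes_code f [x] y \<in> set L"
    using derivation_list_complete by blast
  then show "accepts (recf_code f) x"
    unfolding accepts_def by (metis derivation_list_encode cmem_list_encode)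
qed

lemma RE_accepts: "PR F \<Longrightarrow> PR G \<Longrightarrow> RE (\<lambda>e. accepts (F e) (G e))"
  unfolding accepts_def list_encode_Cons list_encode.simps(1)
  by (rule RE_subst2) (intro RE_intros RE_cmem RE_derivation PR_fact_code PR_ccons
      PR_id PR_const PR_Suc PR_pair PR_pfst PR_psnd)+

lemma recursively_enumerable_RE:
  assumes "recursively_enumerable A" shows "RE (\<lambda>n. n \<in> A)"
proof -
  obtain f where A: "A = {n. \<exists>y. computes f [n] y}"
    using assms unfolding recursively_enumerable_def by blast
  then have "n \<in> A \<longleftrightarrow> accepts (recf_code f) n" for n by (simp add: accepts_recf_code)
  then show ?thesis using RE_accepts[OF PR_const PR_id] by simp
qed

text \<open>
  Cantor's diagonal argument: a scheme that semi-decides the complement of the diagonal would accept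
  its own code if and only if it does not.
\<close>

lemma self_acceptance_not_co_RE: "\<not> RE (\<lambda>n. \<not> accepts n n)"
proof
  assume "RE (\<lambda>n. \<not> accepts n n)"
  from RE_recursively_enumerable[OF this] obtain f
    where "{n. \<not> accepts n n} = {n. \<exists>y. computes f [n] y}"
    unfolding recursively_enumerable_def by blast
  then have "\<not> accepts n n \<longleftrightarrow> accepts (recf_code f) n" for n
    by (auto simp: accepts_recf_code)
  from this[of "recf_code f"] show False by simp
qed

section \<open>Register machines\<close>

text \<open>
  The instructions are chosen so that each acts locally once the content of a register is drawn in
  unary along a line of cells: increment and decrement shift the line by one cell, \<open>Copy\<close> and
  \<open>Clear\<close> act cellwise, and only \<open>Loop\<close> inspects a cell.  The control state is the list of the
  instructions still to be executed.
\<close>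

datatype 'r instr =
    Inc 'r
  | Dec 'r
  | Copy 'r 'r
  | Clear 'r
  | Loop 'r "'r instr list"

type_synonym config = "nat instr list \<times> (nat \<Rightarrow> nat)"

fun step :: "config \<Rightarrow> config" where
  "step ([], s) = ([], s)"
| "step (Inc r # K, s) = (K, s(r := Suc (s r)))"
| "step (Dec r # K, s) = (K, s(r := s r - 1))"
| "step (Copy r q # K, s) = (K, s(r := s q))"
| "step (Clear r # K, s) = (K, s(r := 0))"
| "step (Loop r B # K, s) = (if s r = 0 then K else B @ Loop r B # K, s)"

text \<open>
  Quantifying over the continuation \<open>K\<close> makes the relation compositional.
\<close>

definition exec :: "nat instr list \<Rightarrow> (nat \<Rightarrow> nat) \<Rightarrow> (nat \<Rightarrow> nat) \<Rightarrow> bool" where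
  "exec c s s' \<longleftrightarrow> (\<forall>K. \<exists>t. (step ^^ t) (c @ K, s) = (K, s'))"

lemma exec_Nil: "exec [] s s"
  unfolding exec_def by (auto intro: exI[of _ 0])

lemma exec_append: "exec c s s' \<Longrightarrow> exec c' s' s'' \<Longrightarrow> exec (c @ c') s s''"
  unfolding exec_def
proof
  fix K
  assume "\<forall>K. \<exists>t. (step ^^ t) (c @ K, s) = (K, s')" "\<forall>K. \<exists>t. (step ^^ t) (c' @ K, s') = (K, s'')"
  then obtain t t' where "(step ^^ t) (c @ c' @ K, s) = (c' @ K, s')" "(step ^^ t') (c' @ K, s') = (K, s'')"
    by meson
  then have "(step ^^ (t' + t)) ((c @ c') @ K, s) = (K, s'')" by (simp add: funpow_add)
  then show "\<exists>t. (step ^^ t) ((c @ c') @ K, s) = (K, s'')" by blast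
qed

lemma exec_step: "(\<And>K. step (i # K, s) = (K, s')) \<Longrightarrow> exec [i] s s'"
  unfolding exec_def by (auto intro: exI[of _ 1])

lemma exec_Cons: "(\<And>K. step (i # K, s) = (K, s')) \<Longrightarrow> exec c s' s'' \<Longrightarrow> exec (i # c) s s''"
  using exec_append[OF exec_step] by fastforce

lemma exec_Loop_exit: "s r = 0 \<Longrightarrow> exec [Loop r B] s s"
  by (rule exec_step) simp

lemma exec_Loop_iterate:
  assumes "s r \<noteq> 0" "exec B s s'" "exec [Loop r B] s' s''"
  shows "exec [Loop r B] s s''"
  unfolding exec_def
proof
  fix K
  obtain t where t: "(step ^^ t) ((B @ [Loop r B]) @ K, s) = (K, s'')"
    using exec_append[OF assms(2,3)] unfolding exec_def by blast
  have "(step ^^ Suc t) ([Loop r B] @ K, s) = (K, s'')"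
    using assms(1) t by (simp add: funpow_Suc_right del: funpow.simps)
  then show "\<exists>t. (step ^^ t) ([Loop r B] @ K, s) = (K, s'')" by blast
qed

text \<open>
  The program \<open>c\<close> leaves the value of \<open>F\<close> at the registers \<open>as\<close> in the register \<open>ou\<close>.  The registers
  from \<open>b\<close> on are scratch space whose contents are arbitrary before and after, which spares all
  cleaning up.
\<close>

definition realizes :: "nat instr list \<Rightarrow> (nat list \<Rightarrow> nat) \<Rightarrow> nat list \<Rightarrow> nat \<Rightarrow> nat \<Rightarrow> bool" where
  "realizes c F as ou b \<longleftrightarrow>
    (\<forall>s. \<exists>s'. exec c s s' \<and> s' ou = F (map s as) \<and> (\<forall>r<b. r \<noteq> ou \<longrightarrow> s' r = s r))"

lemma realizes_args:
  assumes "\<And>i. i < length Gs \<Longrightarrow> \<exists>c. realizes c (Gs ! i) as (b + i) (b + length Gs)"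
    and as: "set as \<subseteq> {..<b}"
  shows "\<exists>c. \<forall>s. \<exists>s'. exec c s s' \<and> (\<forall>i<length Gs. s' (b + i) = (Gs ! i) (map s as)) \<and> (\<forall>r<b. s' r = s r)"
proof -
  have "\<exists>c. \<forall>s. \<exists>s'. exec c s s' \<and> (\<forall>i<m. s' (b + i) = (Gs ! i) (map s as)) \<and> (\<forall>r<b. s' r = s r)"
    if "m \<le> length Gs" for m
    using that
  proof (induction m)
    case 0
    show ?case using exec_Nil by (intro exI[of _ "[]"]) auto
  next
    case (Suc m)
    then obtain c where c: "\<And>s. \<exists>s'. exec c s s' \<and> (\<forall>i<m. s' (b + i) = (Gs ! i) (map s as)) \<and> (\<forall>r<b. s' r = s r)"
      by auto
    obtain c' where c': "realizes c' (Gs ! m) as (b + m) (b + length Gs)"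
      using assms(1)[of m] Suc.prems by (auto simp: Suc_le_eq)
    show ?case
    proof (intro exI[of _ "c @ c'"] allI)
      fix s
      obtain s' where s': "exec c s s'" "\<And>i. i < m \<Longrightarrow> s' (b + i) = (Gs ! i) (map s as)"
        "\<And>r. r < b \<Longrightarrow> s' r = s r" using c by blast
      obtain s'' where s'': "exec c' s' s''" "s'' (b + m) = (Gs ! m) (map s' as)"
        "\<And>r. r < b + length Gs \<Longrightarrow> r \<noteq> b + m \<Longrightarrow> s'' r = s' r"
        using c' unfolding realizes_def by blast
      have eq: "map s' as = map s as" using s'(3) as by auto
      have "exec (c @ c') s s'' \<and> (\<forall>i<Suc m. s'' (b + i) = (Gs ! i) (map s as)) \<and> (\<forall>r<b. s'' r = s r)"
        using exec_append[OF s'(1) s''(1)] s'(2,3) s''(2,3) Suc.prems by (auto simp: less_Suc_eq eq)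
      then show "\<exists>s'. exec (c @ c') s s' \<and> (\<forall>i<Suc m. s' (b + i) = (Gs ! i) (map s as)) \<and> (\<forall>r<b. s' r = s r)"
        by blast
    qed
  qed
  then show ?thesis by blast
qed

text \<open>
  Register \<open>b\<close> counts the remaining rounds, \<open>b + 1\<close> the completed ones, and \<open>b + 2\<close> holds the
  value reached; it is an argument of the step program and receives its result.
\<close>

lemma realizes_rec:
  assumes c: "realizes c F as (b + 2) (b + 3)" and as: "set as \<subseteq> {..<b}" and "a < b" "ou < b"
    and d: "realizes d G ((b + 1) # (b + 2) # as) (b + 2) (b + 3)"
  shows "realizes (c @ [Copy b a, Clear (b + 1), Loop b (Dec b # d @ [Inc (b + 1)]), Copy ou (b + 2)])
    (\<lambda>xs. rec_nat (F (tl xs)) (\<lambda>n y. G (n # y # tl xs)) (hd xs)) (a # as) ou b"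
  unfolding realizes_def
proof
  fix s
  define B where "B = Dec b # d @ [Inc (b + 1)]"
  define f where "f = rec_nat (F (map s as)) (\<lambda>n y. G (n # y # map s as))"
  \<comment> \<open>With \<open>k\<close> rounds completed and \<open>n\<close> rounds left, the loop ends with the value of the recursion at \<open>k + n\<close>.\<close>
  have loop: "\<exists>s2. exec [Loop b B] s1 s2 \<and> s2 (b + 2) = f (k + n) \<and> (\<forall>r<b. s2 r = s r)"
    if "s1 b = n" "s1 (b + 1) = k" "s1 (b + 2) = f k" "\<forall>r<b. s1 r = s r" for n k s1
    using that
  proof (induction n arbitrary: k s1)
    case 0
    then show ?case using exec_Loop_exit[of s1 b B] by auto
  next
    case (Suc n)
    define t where "t = s1(b := s1 b - 1)"
    have eq: "map t as = map s as" using Suc.prems(4) as by (auto simp: t_def subset_iff)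
    obtain u where u: "exec d t u" "u (b + 2) = G (map t ((b + 1) # (b + 2) # as))"
      "\<And>r. r < b + 3 \<Longrightarrow> r \<noteq> b + 2 \<Longrightarrow> u r = t r"
      using d unfolding realizes_def by blast
    have u2: "u (b + 2) = G (s1 (b + 1) # s1 (b + 2) # map s as)"
      using u(2) by (simp add: eq) (simp add: t_def)
    have B: "exec B s1 (u(b + 1 := Suc (u (b + 1))))"
      unfolding B_def using u(1)
      by (intro exec_Cons[where s' = t] exec_append exec_step) (auto simp: t_def)
    have "\<exists>s2. exec [Loop b B] (u(b + 1 := Suc (u (b + 1)))) s2 \<and> s2 (b + 2) = f (Suc k + n) \<and> (\<forall>r<b. s2 r = s r)"
      using Suc.prems u2 u(3) by (intro Suc.IH) (auto simp: t_def f_def)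
    then obtain s2 where "exec [Loop b B] (u(b + 1 := Suc (u (b + 1)))) s2" "s2 (b + 2) = f (Suc k + n)" "\<forall>r<b. s2 r = s r"
      by blast
    then show ?case using exec_Loop_iterate[OF _ B] Suc.prems(1) by (intro exI[of _ s2]) auto
  qed
  obtain s1 where s1: "exec c s s1" "s1 (b + 2) = F (map s as)"
    "\<And>r. r < b + 3 \<Longrightarrow> r \<noteq> b + 2 \<Longrightarrow> s1 r = s r" using c unfolding realizes_def by blast
  obtain s2 where s2: "exec [Loop b B] (s1(b := s a, b + 1 := 0)) s2" "s2 (b + 2) = f (s a)" "\<forall>r<b. s2 r = s r"
    using loop[of "s1(b := s a, b + 1 := 0)" "s a" 0] s1 by (auto simp: f_def)
  have "exec ([Copy b a, Clear (b + 1)] @ [Loop b B] @ [Copy ou (b + 2)]) s1 (s2(ou := s2 (b + 2)))"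
    using s2(1) s1(3)[of a] \<open>a < b\<close>
    by (intro exec_append[OF _ exec_append[OF s2(1)]] exec_step)
      (auto intro!: exec_Cons[OF _ exec_step])
  from exec_append[OF s1(1) this]
  show "\<exists>s'. exec (c @ [Copy b a, Clear (b + 1), Loop b (Dec b # d @ [Inc (b + 1)]), Copy ou (b + 2)]) s s' \<and>
    s' ou = rec_nat (F (tl (map s (a # as)))) (\<lambda>n y. G (n # y # tl (map s (a # as)))) (hd (map s (a # as))) \<and>
    (\<forall>r<b. r \<noteq> ou \<longrightarrow> s' r = s r)"
    using s2 \<open>ou < b\<close> by (intro exI[of _ "s2(ou := s2 (b + 2))"]) (auto simp: B_def f_def)
qed

lemma primrec_fn_realizable:
  "primrec_fn k F \<Longrightarrow> length as = k \<Longrightarrow> set as \<subseteq> {..<b} \<Longrightarrow> ou < b \<Longrightarrow> \<exists>c. realizes c F as ou b"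
proof (induction arbitrary: as ou b rule: primrec_fn.induct)
  case (zero k)
  have "exec [Clear ou] s (s(ou := 0))" for s by (rule exec_step) simp
  then have "realizes [Clear ou] (\<lambda>_. 0) as ou b"
    unfolding realizes_def by (meson fun_upd_same fun_upd_other)
  then show ?case by blast
next
  case succ
  then obtain a where [simp]: "as = [a]" by (cases as) auto
  have "exec [Copy ou a, Inc ou] s (s(ou := Suc (s a)))" for s
    by (intro exec_Cons[OF _ exec_step]) auto
  then have "realizes [Copy ou a, Inc ou] (\<lambda>xs. Suc (xs ! 0)) as ou b"
    unfolding realizes_def by (auto intro!: exI[of _ "s(ou := Suc (s a))" for s])
  then show ?case by blast
next
  case (proj i k)
  have "exec [Copy ou (as ! i)] s (s(ou := s (as ! i)))" for s by (rule exec_step) simp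
  then have "realizes [Copy ou (as ! i)] (\<lambda>xs. xs ! i) as ou b"
    unfolding realizes_def using proj by (auto intro!: exI[of _ "s(ou := s (as ! i))" for s])
  then show ?case by blast
next
  case (comp Gs F k)
  have "\<exists>c. realizes c (Gs ! i) as (b + i) (b + length Gs)" if "i < length Gs" for i
  proof -
    have "set as \<subseteq> {..<b + length Gs}" using comp.prems by auto
    then show ?thesis using that comp.IH(2) comp.prems(1) by (metis nth_mem nat_add_left_cancel_less)
  qed
  from realizes_args[OF this comp.prems(2)] obtain c where
    c: "\<And>s. \<exists>s'. exec c s s' \<and> (\<forall>i<length Gs. s' (b + i) = (Gs ! i) (map s as)) \<and> (\<forall>r<b. s' r = s r)"
    by blast
  obtain c' where c': "realizes c' F (map (\<lambda>i. b + i) [0..<length Gs]) ou (b + length Gs)"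
    using comp.IH(1)[of "map (\<lambda>i. b + i) [0..<length Gs]" "b + length Gs" ou] comp.prems
    by (force simp del: image_add_atLeastLessThan image_add_atLeastLessThan')
  show ?case unfolding realizes_def
  proof (intro exI[of _ "c @ c'"] allI)
    fix s
    obtain s' where s': "exec c s s'" "\<And>i. i < length Gs \<Longrightarrow> s' (b + i) = (Gs ! i) (map s as)"
      "\<And>r. r < b \<Longrightarrow> s' r = s r" using c by blast
    obtain s'' where s'': "exec c' s' s''" "s'' ou = F (map s' (map (\<lambda>i. b + i) [0..<length Gs]))"
      "\<And>r. r < b + length Gs \<Longrightarrow> r \<noteq> ou \<Longrightarrow> s'' r = s' r"
      using c' unfolding realizes_def by blast
    have eq: "map s' (map (\<lambda>i. b + i) [0..<length Gs]) = map (\<lambda>G. G (map s as)) Gs"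
      using s'(2) by (auto intro: nth_equalityI)
    have "exec (c @ c') s s'' \<and> s'' ou = F (map (\<lambda>G. G (map s as)) Gs) \<and> (\<forall>r<b. r \<noteq> ou \<longrightarrow> s'' r = s r)"
      using exec_append[OF s'(1) s''(1)] s''(2,3) s'(3) unfolding eq by auto
    then show "\<exists>s'. exec (c @ c') s s' \<and> s' ou = F (map (\<lambda>G. G (map s as)) Gs) \<and> (\<forall>r<b. r \<noteq> ou \<longrightarrow> s' r = s r)"
      by blast
  qed
next
  case (prec k F G)
  then obtain a as' where as: "as = a # as'" "length as' = k" by (cases as) auto
  have "set as' \<subseteq> {..<b + 3}" using as prec.prems by auto
  then obtain c where "realizes c F as' (b + 2) (b + 3)"
    using prec.IH(1)[of as' "b + 3" "b + 2"] as by auto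
  moreover obtain d where "realizes d G ((b + 1) # (b + 2) # as') (b + 2) (b + 3)"
    using prec.IH(2)[of "(b + 1) # (b + 2) # as'" "b + 3" "b + 2"] \<open>set as' \<subseteq> _\<close> as by auto
  moreover have "set as' \<subseteq> {..<b}" "a < b" using as prec.prems by auto
  ultimately show ?case using realizes_rec[of c F as' b a ou d G] prec.prems(3) unfolding as(1)
    by blast
next
  case (cong k F F')
  then show ?case unfolding realizes_def by (metis length_map)
qed

definition run :: "nat instr list \<Rightarrow> nat \<Rightarrow> nat \<Rightarrow> config" where
  "run c n t = (step ^^ t) (c, (\<lambda>_. 0)(0 := n))"

definition halts :: "nat instr list \<Rightarrow> nat \<Rightarrow> bool" where
  "halts c n \<longleftrightarrow> (\<exists>t. fst (run c n t) = [])"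

lemma step_halted:
  assumes "t \<le> t'" "fst ((step ^^ t) x) = []" shows "fst ((step ^^ t') x) = []"
  using assms
proof (induction rule: dec_induct)
  case (step u)
  then show ?case by (cases "(step ^^ u) x") auto
qed simp

text \<open>
  The machine tests \<open>R 0 n\<close>, \<open>R 1 n\<close>, and so on: register 0 keeps the input, register 1 the candidate
  witness, and register 2 the truth value of \<open>\<not> R\<close>, which controls the only unbounded loop.
\<close>

lemma RE_halting_program:
  assumes "RE P" shows "\<exists>c. \<forall>n. halts c n \<longleftrightarrow> P n"
proof -
  obtain R where R: "PRP (\<lambda>z. R (pfst z) (psnd z))" "\<And>e. P e \<longleftrightarrow> (\<exists>t. R t e)"
    using assms unfolding RE_def by blast
  have "PR (\<lambda>z. of_bool (\<not> R (psnd z) (pfst z)))"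
    using PRP_subst[OF PRP_not[OF R(1)], of "\<lambda>z. pair (psnd z) (pfst z)"]
    by (simp add: PRP_def PR_intros)
  from primrec_fn_app1[OF this[unfolded PR_def] primrec_fn_pair[OF primrec_fn.proj[of 0 2] primrec_fn.proj[of 1 2]]]
  have "primrec_fn 2 (\<lambda>xs. of_bool (\<not> R (xs ! 1) (xs ! 0)))" by simp
  then obtain d where "realizes d (\<lambda>xs. of_bool (\<not> R (xs ! 1) (xs ! 0))) [0, 1] 2 3"
    using primrec_fn_realizable[of 2 _ "[0, 1]" 3 2] by auto
  then have d: "\<exists>s'. exec d s s' \<and> s' 0 = s 0 \<and> s' 1 = s 1 \<and> s' 2 = of_bool (\<not> R (s 1) (s 0))" for s
  proof -
    from \<open>realizes d _ _ _ _\<close> obtain s' where "exec d s s'"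
      "s' 2 = of_bool (\<not> R (map s [0, 1] ! 1) (map s [0, 1] ! 0))" "\<And>r. r < 3 \<Longrightarrow> r \<noteq> 2 \<Longrightarrow> s' r = s r"
      unfolding realizes_def by blast
    then show ?thesis by (intro exI[of _ s']) simp
  qed
  define L where "L = Loop 2 (d @ [Inc 1])"
  have iter: "\<exists>t s'. t > 0 \<and> (step ^^ t) ([L], s) = ([L], s') \<and>
      s' 0 = s 0 \<and> s' 1 = Suc (s 1) \<and> s' 2 = of_bool (\<not> R (s 1) (s 0))" if "s 2 \<noteq> 0" for s
  proof -
    obtain s' where s': "exec d s s'" "s' 0 = s 0" "s' 1 = s 1" "s' 2 = of_bool (\<not> R (s 1) (s 0))"
      using d by blast
    have "exec (d @ [Inc 1]) s (s'(1 := Suc (s' 1)))"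
      by (intro exec_append[OF s'(1)] exec_step) simp
    then obtain t where "(step ^^ t) ((d @ [Inc 1]) @ [L], s) = ([L], s'(1 := Suc (s' 1)))"
      unfolding exec_def by blast
    then have "(step ^^ Suc t) ([L], s) = ([L], s'(1 := Suc (s' 1)))"
      using that unfolding L_def by (simp add: funpow_Suc_right del: funpow.simps)
    then show ?thesis using s' by (intro exI[of _ "Suc t"] exI[of _ "s'(1 := Suc (s' 1))"]) auto
  qed
  \<comment> \<open>If no witness lies below \<open>t\<close>, the loop is entered with candidate \<open>t\<close>, and not before time \<open>t\<close>.\<close>
  have unfinished: "\<exists>T s. T \<ge> t \<and> run [Inc 2, L] n T = ([L], s) \<and> s 0 = n \<and> s 1 = t \<and> s 2 = 1"
    if "\<And>u. u < t \<Longrightarrow> \<not> R u n" for t n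
    using that
  proof (induction t)
    case 0
    show ?case by (intro exI[of _ 1]) (simp add: run_def)
  next
    case (Suc t)
    then obtain T s where T: "T \<ge> t" "run [Inc 2, L] n T = ([L], s)" "s 0 = n" "s 1 = t" "s 2 = 1"
      by auto
    obtain t' s' where t': "t' > 0" "(step ^^ t') ([L], s) = ([L], s')"
      "s' 0 = s 0" "s' 1 = Suc (s 1)" "s' 2 = of_bool (\<not> R (s 1) (s 0))"
      using iter[of s] T by auto
    have "run [Inc 2, L] n (t' + T) = ([L], s')" using T(2) t'(2) by (simp add: run_def funpow_add)
    then show ?case using T t' Suc.prems[of t]
      by (intro exI[of _ "t' + T"] exI[of _ s']) auto
  qed
  have "halts [Inc 2, L] n \<longleftrightarrow> (\<exists>t. R t n)" for n
  proof
    assume "halts [Inc 2, L] n"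
    then obtain t where t: "fst (run [Inc 2, L] n t) = []" unfolding halts_def by blast
    show "\<exists>t. R t n"
    proof (rule ccontr)
      assume "\<not> ?thesis"
      then obtain T s where "T \<ge> t" "run [Inc 2, L] n T = ([L], s)" using unfinished[of t n] by blast
      then show False using step_halted[of t T] t unfolding run_def by fastforce
    qed
  next
    assume "\<exists>t. R t n"
    define t where "t = (LEAST t. R t n)"
    have t: "R t n" "\<And>u. u < t \<Longrightarrow> \<not> R u n"
      using \<open>\<exists>t. R t n\<close> unfolding t_def by (auto intro: LeastI_ex dest: not_less_Least)
    from unfinished[OF t(2)] obtain T s where T: "run [Inc 2, L] n T = ([L], s)" "s 0 = n" "s 1 = t" "s 2 = 1"
      by blast
    obtain t' s' where t': "(step ^^ t') ([L], s) = ([L], s')" "s' 2 = 0"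
      using iter[of s] T t by auto
    have "run [Inc 2, L] n (Suc (t' + T)) = ([], s')"
      using T(1) t' by (simp add: run_def funpow_add L_def)
    then show "halts [Inc 2, L] n" unfolding halts_def by (metis fst_conv)
  qed
  then show ?thesis using R(2) by blast
qed

section \<open>Seeded tilings that simulate a machine\<close>

text \<open>
  A finite set of instruction lists that contains all control states reachable from the argument.  While
  the body of a loop is being executed, the control state is a continuation of the body followed by
  the loop itself.
\<close>

fun conts :: "'r instr list \<Rightarrow> 'r instr list set" where
  "conts [] = {[]}"
| "conts (Loop r B # K) = insert (Loop r B # K) ((\<lambda>c. c @ Loop r B # K) ` conts B \<union> conts K)"
| "conts (i # K) = insert (i # K) (conts K)"

lemma finite_conts: "finite (conts c)"
  by (induction c rule: conts.induct) auto

lemma conts_refl: "c \<in> conts c"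
  by (induction c rule: conts.induct) auto

lemma step_append: "c \<noteq> [] \<Longrightarrow> fst (step (c @ K, s)) = fst (step (c, s)) @ K"
  by (cases "(c, s)" rule: step.cases) auto

lemma conts_step: "K \<in> conts c \<Longrightarrow> fst (step (K, s)) \<in> conts c"
proof (induction c arbitrary: K rule: conts.induct)
  case (2 r B K0)
  have self: "fst (step (Loop r B # K0, s)) \<in> conts (Loop r B # K0)"
    using conts_refl[of B] conts_refl[of K0] by auto
  from 2(3) consider "K = Loop r B # K0" | c where "c \<in> conts B" "K = c @ Loop r B # K0" | "K \<in> conts K0"
    by auto
  then show ?case
  proof cases
    case (2 c)
    show ?thesis
    proof (cases "c = []")
      case False
      then show ?thesis using 2 "2.IH"(1)[of c] by (simp add: step_append)
    qed (use 2 self in simp)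
  qed (use self "2.IH" in auto)
qed (use conts_refl in \<open>force+\<close>)

definition regs_of :: "'r instr list \<Rightarrow> 'r set" where "regs_of K = (\<Union>i\<in>set K. set_instr i)"

lemma finite_set_instr: "finite (set_instr i)"
  by (induction i) auto

lemma regs_of_step: "regs_of (fst (step (K, s))) \<subseteq> regs_of K"
  by (cases "(K, s)" rule: step.cases) (auto simp: regs_of_def)

lemma run_Suc: "run c n (Suc t) = step (run c n t)"
  by (simp add: run_def)

lemma run_conts: "fst (run c n t) \<in> conts c"
proof (induction t)
  case (Suc t)
  then show ?case using conts_step[of "fst (run c n t)" c "snd (run c n t)"] by (simp add: run_Suc)
qed (simp add: run_def conts_refl)

lemma run_regs_of: "regs_of (fst (run c n t)) \<subseteq> regs_of c"
proof (induction t)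
  case (Suc t)
  then show ?case using regs_of_step[of "fst (run c n t)" "snd (run c n t)"] by (simp add: run_Suc)
qed (simp add: run_def)

text \<open>
  Space-time diagrams.  Row \<open>y\<close> of the plane shows the machine at time \<open>y\<close>: every cell of the row
  carries the control state, the bit \<open>base\<close> is set at the columns \<open>x \<le> 0\<close>, and the register \<open>q\<close> with
  content \<open>r\<close> is drawn by its bit at the columns \<open>x \<le> r\<close>.  The state \<open>None\<close> fills the rows
  before time 0, on which no machine rule is imposed.
\<close>

datatype cell = Cell (ctrl: "nat instr list option") (base: bool) (regs: "nat set")

text \<open>
  The cells \<open>a\<close>, \<open>b\<close> lie next to each other in one row, and \<open>c\<close>, \<open>d\<close> above them in the next row.
  An increment moves the drawn line to the right and is therefore checked at \<open>a\<close> and \<open>d\<close>.  Truncation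
  of a decrement at 0 keeps the base cells filled.
\<close>

fun layer_rule :: "nat instr \<Rightarrow> nat \<Rightarrow> cell \<Rightarrow> cell \<Rightarrow> cell \<Rightarrow> cell \<Rightarrow> bool" where
  "layer_rule (Inc r) q a b c d =
     (if q = r then q \<in> regs d \<longleftrightarrow> q \<in> regs a else q \<in> regs c \<longleftrightarrow> q \<in> regs a)"
| "layer_rule (Dec r) q a b c d = (q \<in> regs c \<longleftrightarrow> (if q = r then q \<in> regs b \<or> base a else q \<in> regs a))"
| "layer_rule (Copy r p) q a b c d = (q \<in> regs c \<longleftrightarrow> (if q = r then p else q) \<in> regs a)"
| "layer_rule (Clear r) q a b c d = (q \<in> regs c \<longleftrightarrow> (if q = r then base a else q \<in> regs a))"
| "layer_rule (Loop r B) q a b c d = (q \<in> regs c \<longleftrightarrow> q \<in> regs a)"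

text \<open>
  A register is nonzero exactly if its bit is set in column 1, so \<open>P\<close> is to be the set of registers
  set in that column.
\<close>

fun successor :: "nat instr list \<Rightarrow> nat set \<Rightarrow> nat instr list" where
  "successor [] _ = []"
| "successor (Loop r B # K) P = (if r \<in> P then B @ Loop r B # K else K)"
| "successor (_ # K) _ = K"

lemma successor_step: "\<forall>q\<in>regs_of K. q \<in> P \<longleftrightarrow> s q \<noteq> 0 \<Longrightarrow> successor K P = fst (step (K, s))"
  by (cases "(K, s)" rule: step.cases) (auto simp: regs_of_def)

text \<open>
  The control state is constant along each row, which makes it available wherever a register ends.
  Columns 0 and 1 are recognised locally as the place where the base ends, and it is there
  that the loop tests are made and the next control state is fixed.  The empty control state is forbidden:
  a halting run cannot be continued.
\<close>

definition tile_rule :: "cell \<Rightarrow> cell \<Rightarrow> cell \<Rightarrow> cell \<Rightarrow> bool" where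
  "tile_rule a b c d \<longleftrightarrow>
     ctrl a = ctrl b \<and> base c = base a \<and> (base b \<longrightarrow> base a) \<and> regs b \<subseteq> regs a \<and>
     (\<forall>K. ctrl a = Some K \<longrightarrow> K \<noteq> [] \<and> (\<forall>q. layer_rule (hd K) q a b c d) \<and>
       (base a \<and> \<not> base b \<longrightarrow> ctrl c = Some (successor K (regs b))))"

lemma int_down_set:
  fixes P :: "int \<Rightarrow> bool"
  assumes "\<And>x. P (x + 1) \<Longrightarrow> P x" "P v" "\<not> P (v + 1)"
  shows "P x \<longleftrightarrow> x \<le> v"
proof -
  have below: "P y" if "y \<le> v" for y
    using that by (induction rule: int_le_induct) (use assms(1)[of "i - 1" for i] assms(2) in auto)
  have above: "\<not> P y" if "v + 1 \<le> y" for y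
    using that by (induction rule: int_ge_induct) (use assms in auto)
  show ?thesis using below[of x] above[of x] by linarith
qed

lemma int_shift_invariant:
  fixes f :: "int \<Rightarrow> 'a"
  assumes "\<And>x. f x = f (x + 1)" shows "f x = f 0"
proof (induction x rule: int_induct[of _ 0])
  case (step1 i)
  then show ?case using assms[of i] by simp
next
  case (step2 i)
  then show ?case using assms[of "i - 1"] by simp
qed simp

text \<open>
  If a row draws the registers correctly, then the layer rule forces the next row to do so.
\<close>

lemma layer_rule_step:
  assumes "K \<noteq> []" "q \<in> G" "regs_of K \<subseteq> G"
    and row: "\<And>x p. p \<in> G \<Longrightarrow> p \<in> regs (X x) \<longleftrightarrow> x \<le> int (s p)" "\<And>x. base (X x) \<longleftrightarrow> x \<le> 0"
    and rule: "\<And>x. layer_rule (hd K) q (X x) (X (x + 1)) (Y x) (Y (x + 1))"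
  shows "q \<in> regs (Y x) \<longleftrightarrow> x \<le> int (snd (step (K, s)) q)"
proof -
  obtain i K' where K: "K = i # K'" using assms(1) by (cases K) auto
  have i: "set_instr i \<subseteq> G" using assms(3) K by (auto simp: regs_of_def)
  show ?thesis
    using rule[of x] rule[of "x - 1"] row(1)[of q] row(2) i assms(2)
    by (cases i) (auto simp: K row split: if_splits)
qed

text \<open>
  The base has to end at column 0 in row 0 and the input has to be \<open>n\<close>.  Since all bits are monotone along
  rows, this is a condition on four cells of row 0: columns 0 and 1 fix the base, the control state and
  the value 0 of the other registers, columns \<open>n\<close> and \<open>n + 1\<close> fix the input register.
\<close>

definition seed_conditions :: "nat instr list \<Rightarrow> nat set \<Rightarrow> nat \<Rightarrow> (nat \<times> (cell \<Rightarrow> bool)) list" where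
  "seed_conditions c G n =
    [(0, \<lambda>z. ctrl z = Some c \<and> base z \<and> G - {0} \<subseteq> regs z),
     (1, \<lambda>z. \<not> base z \<and> (G - {0}) \<inter> regs z = {}),
     (n, \<lambda>z. 0 \<in> regs z),
     (Suc n, \<lambda>z. 0 \<notin> regs z)]"

text \<open>
  From the seed upwards the rules leave no choice: row \<open>t\<close> shows the machine at time \<open>t\<close>.
\<close>

lemma tiling_not_halts:
  fixes X :: "int \<Rightarrow> int \<Rightarrow> cell"
  assumes G: "regs_of c \<subseteq> G"
    and rule: "\<And>x y. tile_rule (X x y) (X (x + 1) y) (X x (y + 1)) (X (x + 1) (y + 1))"
    and seed: "\<And>v P. (v, P) \<in> set (seed_conditions c G n) \<Longrightarrow> P (X (int v) 0)"
  shows "\<not> halts c n"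
proof -
  have "\<forall>(v, P)\<in>set (seed_conditions c G n). P (X (int v) 0)" using seed by blast
  then have seeds: "ctrl (X 0 0) = Some c" "base (X 0 0)" "\<And>q. q \<in> G \<Longrightarrow> q \<noteq> 0 \<Longrightarrow> q \<in> regs (X 0 0)"
    "\<not> base (X 1 0)" "\<And>q. q \<in> G \<Longrightarrow> q \<noteq> 0 \<Longrightarrow> q \<notin> regs (X 1 0)"
    "0 \<in> regs (X (int n) 0)" "0 \<notin> regs (X (int n + 1) 0)"
    unfolding seed_conditions_def by (auto simp: add.commute)
  have ctrl: "ctrl (X x y) = ctrl (X 0 y)" for x y
    using int_shift_invariant[of "\<lambda>x. ctrl (X x y)" x] rule unfolding tile_rule_def by blast
  have base0: "base (X x 0) \<longleftrightarrow> x \<le> 0" for x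
    using seeds rule by (intro int_down_set) (auto simp: tile_rule_def)
  have base: "base (X x (int t)) \<longleftrightarrow> x \<le> 0" for x t
  proof (induction t)
    case (Suc t)
    then show ?case using rule[of x "int t"] by (simp add: tile_rule_def add.commute)
  qed (simp add: base0)
  have inv: "ctrl (X 0 (int t)) = Some (fst (run c n t)) \<and>
      (\<forall>q\<in>G. \<forall>x. q \<in> regs (X x (int t)) \<longleftrightarrow> x \<le> int (snd (run c n t) q))" for t
  proof (induction t)
    case 0
    have "q \<in> regs (X x 0) \<longleftrightarrow> x \<le> int (((\<lambda>_. 0)(0 := n)) q)" if "q \<in> G" for q x
    proof (rule int_down_set)
      show "q \<in> regs (X (x + 1) 0) \<Longrightarrow> q \<in> regs (X x 0)" for x
        using rule[of x 0] by (auto simp: tile_rule_def)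
    qed (use seeds that in \<open>auto\<close>)
    then show ?case using seeds(1) by (simp add: run_def)
  next
    case (Suc t)
    obtain K s where Ks: "run c n t = (K, s)" by fastforce
    have K: "ctrl (X x (int t)) = Some K" for x using Suc Ks ctrl[of x] by simp
    have regs: "q \<in> regs (X x (int t)) \<longleftrightarrow> x \<le> int (s q)" if "q \<in> G" for q x
      using Suc Ks that by simp
    have KG: "regs_of K \<subseteq> G" using run_regs_of[of c n t] G Ks by simp
    have r: "K \<noteq> []" "\<And>x q. layer_rule (hd K) q (X x (int t)) (X (x + 1) (int t)) (X x (int t + 1)) (X (x + 1) (int t + 1))"
      using rule[of _ "int t"] K unfolding tile_rule_def by auto
    have "ctrl (X 0 (int t + 1)) = Some (successor K (regs (X 1 (int t))))"
      using rule[of 0 "int t"] K base[of _ t] unfolding tile_rule_def by simp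
    moreover have "successor K (regs (X 1 (int t))) = fst (step (K, s))"
      using regs KG by (intro successor_step) auto
    moreover have "q \<in> regs (X x (int t + 1)) \<longleftrightarrow> x \<le> int (snd (step (K, s)) q)" if "q \<in> G" for q x
      by (rule layer_rule_step[where X = "\<lambda>x. X x (int t)" and Y = "\<lambda>x. X x (int t + 1)" and G = G])
        (use that r KG regs base in auto)
    ultimately show ?case by (simp add: run_Suc Ks add.commute)
  qed
  show ?thesis
    unfolding halts_def
  proof
    assume "\<exists>t. fst (run c n t) = []"
    then obtain t where "fst (run c n t) = []" ..
    then show False using inv[of t] rule[of 0 "int t"] by (auto simp: tile_rule_def)
  qed
qed

definition machine_tiling :: "nat instr list \<Rightarrow> nat set \<Rightarrow> nat \<Rightarrow> int \<Rightarrow> int \<Rightarrow> cell" where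
  "machine_tiling c G n x y =
     Cell (if y < 0 then None else Some (fst (run c n (nat y)))) (x \<le> 0)
       {q \<in> G. x \<le> int (snd (run c n (nat y)) q)}"

lemma machine_tiling_rule:
  assumes "\<not> halts c n" "regs_of c \<subseteq> G"
  shows "tile_rule (machine_tiling c G n x y) (machine_tiling c G n (x + 1) y)
    (machine_tiling c G n x (y + 1)) (machine_tiling c G n (x + 1) (y + 1))"
proof (cases "y < 0")
  case True
  then show ?thesis by (auto simp: tile_rule_def machine_tiling_def)
next
  case False
  define t where "t = nat y"
  have y: "y = int t" "nat (int t + 1) = Suc t" using False by (auto simp: t_def)
  obtain K s where Ks: "run c n t = (K, s)" by fastforce
  have "K \<noteq> []" using assms(1) Ks unfolding halts_def by (metis fst_conv)
  then obtain i K' where K: "K = i # K'" by (cases K) auto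
  have "regs_of K \<subseteq> G" using run_regs_of[of c n t] assms(2) Ks by simp
  then have i: "set_instr i \<subseteq> G" "regs_of K \<subseteq> G" using K by (auto simp: regs_of_def)
  have "layer_rule i q (machine_tiling c G n x y) (machine_tiling c G n (x + 1) y)
    (machine_tiling c G n x (y + 1)) (machine_tiling c G n (x + 1) (y + 1))" for q
    using i by (cases i) (auto simp: machine_tiling_def y run_Suc Ks K)
  moreover have "successor K (regs (machine_tiling c G n (x + 1) y)) = fst (step (K, s))"
    if "x \<le> 0" "\<not> x + 1 \<le> 0"
    using that i(2) by (intro successor_step) (auto simp: machine_tiling_def y Ks subset_iff)
  ultimately show ?thesis using K
    by (auto simp: tile_rule_def) (auto simp: machine_tiling_def y run_Suc Ks)
qed

lemma machine_tiling_seed: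
  "(v, P) \<in> set (seed_conditions c (insert 0 G) n) \<Longrightarrow> P (machine_tiling c (insert 0 G) n (int v) 0)"
  by (auto simp: seed_conditions_def machine_tiling_def run_def)

definition valid_tiling :: "(nat \<times> nat \<times> nat \<times> nat) set \<Rightarrow> (int \<Rightarrow> int \<Rightarrow> nat) \<Rightarrow> bool" where
  "valid_tiling W X \<longleftrightarrow> (\<forall>x y. (X x y, X (x + 1) y, X x (y + 1), X (x + 1) (y + 1)) \<in> W)"

definition seeded :: "(nat \<times> nat set) list \<Rightarrow> (int \<Rightarrow> int \<Rightarrow> nat) \<Rightarrow> bool" where
  "seeded Q X \<longleftrightarrow> (\<forall>(v, A)\<in>set Q. X (int v) 0 \<in> A)"

text \<open>
  Cells become numbers through an injection of the finitely many that can occur.  Tile set and labels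
  depend on the program only; the input enters through the position of the seed.
\<close>

lemma seeded_tilings_encode_halting:
  "\<exists>W A0 A1 A2 A3. finite W \<and> finite A0 \<and> finite A1 \<and> finite A2 \<and> finite A3 \<and>
     (\<forall>n. (\<exists>X. valid_tiling W X \<and> seeded [(0, A0), (1, A1), (n, A2), (Suc n, A3)] X) \<longleftrightarrow> \<not> halts c n)"
proof -
  define G where "G = insert 0 (regs_of c)"
  have G: "regs_of c \<subseteq> G" "finite G" unfolding G_def by (auto simp: regs_of_def finite_set_instr)
  define C where "C = (\<lambda>(k, b, P). Cell k b P) ` (insert None (Some ` conts c) \<times> UNIV \<times> Pow G)"
  have C: "finite C" unfolding C_def using G(2) by (simp add: finite_conts)
  then obtain f :: "cell \<Rightarrow> nat" where f: "inj_on f C" using finite_imp_inj_to_nat_seg by metis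
  define W where "W = (\<lambda>(a, b, c, d). (f a, f b, f c, f d)) ` {(a, b, c, d). a \<in> C \<and> b \<in> C \<and> c \<in> C \<and> d \<in> C \<and> tile_rule a b c d}"
  have "finite W" unfolding W_def
    by (rule finite_imageI, rule finite_subset[of _ "C \<times> C \<times> C \<times> C"]) (use C in auto)
  define A where "A P = f ` {z \<in> C. P z}" for P
  define g where "g = inv_into C f"
  have gf: "g (f z) = z" if "z \<in> C" for z using f that unfolding g_def by (rule inv_into_f_f)
  define Q where "Q n = map (\<lambda>(v, P). (v, A P)) (seed_conditions c G n)" for n
  have "(\<exists>X. valid_tiling W X \<and> seeded (Q n) X) \<longleftrightarrow> \<not> halts c n" for n
  proof
    assume "\<exists>X. valid_tiling W X \<and> seeded (Q n) X"
    then obtain X where X: "valid_tiling W X" "seeded (Q n) X" by blast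
    have "tile_rule (g (X x y)) (g (X (x + 1) y)) (g (X x (y + 1))) (g (X (x + 1) (y + 1)))" for x y
      using X(1)[unfolded valid_tiling_def, rule_format, of x y] unfolding W_def by (auto simp: gf)
    moreover have "P (g (X (int v) 0))" if "(v, P) \<in> set (seed_conditions c G n)" for v P
    proof -
      have "(v, A P) \<in> set (Q n)" using that by (force simp: Q_def)
      then show ?thesis using X(2) by (auto simp: seeded_def A_def gf)
    qed
    ultimately show "\<not> halts c n" by (rule tiling_not_halts[OF G(1)])
  next
    assume nh: "\<not> halts c n"
    define X where "X x y = f (machine_tiling c G n x y)" for x y
    have inC: "machine_tiling c G n x y \<in> C" for x y
    proof -
      let ?k = "if y < 0 then None else Some (fst (run c n (nat y)))"
      have "?k \<in> insert None (Some ` conts c)" using run_conts[of c n] by auto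
      then show ?thesis unfolding machine_tiling_def C_def
        by (intro image_eqI[of _ _ "(?k, x \<le> 0, {q \<in> G. x \<le> int (snd (run c n (nat y)) q)})"]) auto
    qed
    have "valid_tiling W X"
      unfolding valid_tiling_def
    proof (intro allI)
      fix x y
      let ?T = "machine_tiling c G n"
      show "(X x y, X (x + 1) y, X x (y + 1), X (x + 1) (y + 1)) \<in> W"
        unfolding W_def
        by (intro image_eqI[of _ _ "(?T x y, ?T (x + 1) y, ?T x (y + 1), ?T (x + 1) (y + 1))"])
          (auto simp: X_def inC machine_tiling_rule[OF nh G(1)])
    qed
    moreover have "seeded (Q n) X"
      using inC machine_tiling_seed[of _ _ c "regs_of c" n]
      by (auto simp: seeded_def Q_def X_def A_def G_def[symmetric] intro!: imageI)
    ultimately show "\<exists>X. valid_tiling W X \<and> seeded (Q n) X" by blast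
  qed
  moreover have "Q n = [(0, A (snd (seed_conditions c G 0 ! 0))), (1, A (snd (seed_conditions c G 0 ! 1))),
      (n, A (snd (seed_conditions c G 0 ! 2))), (Suc n, A (snd (seed_conditions c G 0 ! 3)))]" for n
    by (simp add: Q_def seed_conditions_def)
  moreover have "finite (A P)" for P unfolding A_def using C by auto
  ultimately show ?thesis using \<open>finite W\<close> by metis
qed

section \<open>The prefix topology of the Cantor set\<close>

text \<open>
  Open sets and continuity in terms of finite prefixes.
\<close>

definition agree :: "nat \<Rightarrow> cantor \<Rightarrow> cantor \<Rightarrow> bool" where
  "agree n x y \<longleftrightarrow> (\<forall>i<n. x i = y i)"

lemma agree_refl [simp]: "agree n x x" by (simp add: agree_def)
lemma agree_sym: "agree n x y \<Longrightarrow> agree n y x" by (simp add: agree_def)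
lemma agree_trans: "agree n x y \<Longrightarrow> agree n y z \<Longrightarrow> agree n x z" by (simp add: agree_def)
lemma agree_mono: "agree n x y \<Longrightarrow> m \<le> n \<Longrightarrow> agree m x y" by (simp add: agree_def)
lemma agree_eqI: "(\<And>n. agree n x y) \<Longrightarrow> x = y" by (auto simp: agree_def fun_eq_iff)

lemma open_cantor_iff: "open U \<longleftrightarrow> (\<forall>x\<in>U. \<exists>n. \<forall>y. agree n x y \<longrightarrow> y \<in> U)"
proof -
  interpret Metric_space UNIV cantor_dist by (rule Metric_space_cantor_dist)
  have "open U \<longleftrightarrow> openin mtopology U" by (simp add: mtopology_cantor_dist)
  also have "\<dots> \<longleftrightarrow> (\<forall>x\<in>U. \<exists>r>0. mball x r \<subseteq> U)" by (auto simp: openin_mtopology)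
  also have "\<dots> \<longleftrightarrow> (\<forall>x\<in>U. \<exists>n. \<forall>y. agree n x y \<longrightarrow> y \<in> U)"
  proof (intro ball_cong refl iffI)
    fix x assume "\<exists>r>0. mball x r \<subseteq> U"
    then obtain r where r: "r > 0" "mball x r \<subseteq> U" by blast
    then obtain n where n: "(1/2) ^ n < r" using real_arch_pow_inv[of r "1/2"] by auto
    have "y \<in> U" if "agree (Suc n) x y" for y
    proof -
      have "cantor_dist x y < (1/2) ^ n" using that by (simp add: cantor_dist_less_iff agree_def less_Suc_eq_le)
      then show ?thesis using n r(2) by (auto simp: in_mball)
    qed
    then show "\<exists>n. \<forall>y. agree n x y \<longrightarrow> y \<in> U" by blast
  next
    fix x assume "\<exists>n. \<forall>y. agree n x y \<longrightarrow> y \<in> U"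
    then obtain n where n: "\<And>y. agree n x y \<Longrightarrow> y \<in> U" by blast
    have "mball x ((1/2) ^ n) \<subseteq> U"
      by (auto simp: in_mball cantor_dist_less_iff agree_def intro!: n)
    then show "\<exists>r>0. mball x r \<subseteq> U" by (intro exI[of _ "(1/2) ^ n"]) auto
  qed
  finally show ?thesis .
qed

lemma open_agree: "open {y. agree n x y}"
  unfolding open_cantor_iff by (blast intro: agree_trans)

lemma continuous_cantor_iff:
  fixes f :: "cantor \<Rightarrow> cantor"
  shows "continuous_on UNIV f \<longleftrightarrow> (\<forall>x n. \<exists>m. \<forall>y. agree m x y \<longrightarrow> agree n (f x) (f y))"
proof
  assume f: "continuous_on UNIV f"
  show "\<forall>x n. \<exists>m. \<forall>y. agree m x y \<longrightarrow> agree n (f x) (f y)"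
  proof (intro allI)
    fix x n
    have "open (f -` {y. agree n (f x) y})"
      using f open_agree continuous_on_open_vimage[OF open_UNIV] by force
    then show "\<exists>m. \<forall>y. agree m x y \<longrightarrow> agree n (f x) (f y)"
      unfolding open_cantor_iff by auto
  qed
next
  assume R: "\<forall>x n. \<exists>m. \<forall>y. agree m x y \<longrightarrow> agree n (f x) (f y)"
  have "open (f -` U)" if "open U" for U
    unfolding open_cantor_iff
  proof
    fix x assume "x \<in> f -` U"
    then obtain n where "\<And>y. agree n (f x) y \<Longrightarrow> y \<in> U" using \<open>open U\<close> unfolding open_cantor_iff by blast
    then show "\<exists>n. \<forall>y. agree n x y \<longrightarrow> y \<in> f -` U" using R by (metis vimageI)
  qed
  then show "continuous_on UNIV f" by (simp add: continuous_on_open_vimage[OF open_UNIV])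
qed

lemma compact_cantor: "compact (UNIV :: cantor set)"
proof -
  have "compact (UNIV :: bool set)" by (simp add: finite_imp_compact)
  then have "compact_space (euclidean :: bool topology)" by (simp add: compact_space_def)
  then have "compact_space (product_topology (\<lambda>_. euclidean :: bool topology) (UNIV :: nat set))"
    by (simp add: compact_space_product_topology)
  then show ?thesis by (simp add: compact_space_def euclidean_product_topology)
qed

text \<open>
  By compactness, a locally constant function depends on a prefix of fixed length only.
\<close>

lemma locally_constant_uniform:
  fixes f :: "cantor \<Rightarrow> 'b"
  assumes "\<And>x. \<exists>m. \<forall>y. agree m x y \<longrightarrow> f y = f x"
  obtains m where "\<And>x y. agree m x y \<Longrightarrow> f x = f y"
proof -
  obtain r where r: "\<And>x y. agree (r x) x y \<Longrightarrow> f y = f x" using assms by metis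
  have "UNIV \<subseteq> (\<Union>x. {y. agree (r x) x y})" by auto
  then obtain D where D: "finite D" "UNIV \<subseteq> (\<Union>x\<in>D. {y. agree (r x) x y})"
    by (rule compactE_image[OF compact_cantor open_agree])
  define m where "m = (\<Sum>x\<in>D. r x)"
  have "f x = f y" if "agree m x y" for x y
  proof -
    obtain w where w: "w \<in> D" "agree (r w) w x" using D(2) by blast
    have "r w \<le> m" unfolding m_def using D(1) w(1) by (simp add: member_le_sum)
    then have "agree (r w) w y" using that w(2) agree_trans agree_mono by blast
    then show ?thesis using r w(2) by metis
  qed
  then show ?thesis using that by blast
qed

section \<open>A closed subset times the Cantor set is a Cantor set\<close>

text \<open>
  For a nonempty closed set \<open>Y\<close>, the product of \<open>Y\<close> with the Cantor set is homeomorphic to the Cantor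
  set by an explicit map.  The pair \<open>(y, z)\<close> is written as one bit stream: bit \<open>n\<close> of \<open>y\<close> is written
  only if the elements of \<open>Y\<close> that share the first \<open>n\<close> bits of \<open>y\<close> disagree about it, and it is followed by
  bit \<open>n\<close> of \<open>z\<close>.  A bit that is omitted can be recovered, so the map is injective; every bit that is
  written is free, so it is surjective; and since every round writes one or two bits, finite prefixes
  determine finite prefixes in both directions.
\<close>

definition branches :: "cantor set \<Rightarrow> cantor \<Rightarrow> nat \<Rightarrow> bool" where
  "branches Y y n \<longleftrightarrow> (\<forall>b. \<exists>w\<in>Y. agree n w y \<and> w n = b)"

primrec interleave :: "cantor set \<Rightarrow> cantor \<Rightarrow> cantor \<Rightarrow> nat \<Rightarrow> bool list" where
  "interleave Y y z 0 = []"
| "interleave Y y z (Suc n) = interleave Y y z n @ (if branches Y y n then [y n, z n] else [z n])"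

definition weave :: "cantor set \<Rightarrow> cantor \<Rightarrow> cantor \<Rightarrow> cantor" where
  "weave Y y z k = interleave Y y z (Suc k) ! k"

lemma length_interleave: "n \<le> length (interleave Y y z n)" "length (interleave Y y z n) \<le> 2 * n"
  by (induction n) auto

lemma interleave_prefix: "n \<le> m \<Longrightarrow> \<exists>w. interleave Y y z m = interleave Y y z n @ w"
  by (induction m rule: dec_induct) auto

lemma weave_nth: "k < length (interleave Y y z n) \<Longrightarrow> weave Y y z k = interleave Y y z n ! k"
proof -
  assume k: "k < length (interleave Y y z n)"
  have k': "k < length (interleave Y y z (Suc k))" using length_interleave(1)[of "Suc k" Y y z] by simp
  obtain w where "interleave Y y z (max n (Suc k)) = interleave Y y z n @ w"
    using interleave_prefix[OF max.cobounded1] by blast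
  moreover obtain w' where "interleave Y y z (max n (Suc k)) = interleave Y y z (Suc k) @ w'"
    using interleave_prefix[OF max.cobounded2] by blast
  ultimately show ?thesis unfolding weave_def using k k' by (metis nth_append_left)
qed

lemma branches_cong: "agree n y y' \<Longrightarrow> branches Y y n \<longleftrightarrow> branches Y y' n"
proof -
  assume "agree n y y'"
  then have "agree n w y \<longleftrightarrow> agree n w y'" for w by (auto simp: agree_def)
  then show ?thesis unfolding branches_def by simp
qed

lemma interleave_cong: "agree n y y' \<Longrightarrow> agree n z z' \<Longrightarrow> interleave Y y z n = interleave Y y' z' n"
proof (induction n)
  case (Suc n)
  then have "agree n y y'" "agree n z z'" "y n = y' n" "z n = z' n" by (auto simp: agree_def)
  then show ?case using Suc.IH branches_cong[of n y y'] by simp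
qed simp

lemma weave_agree: "agree n y y' \<Longrightarrow> agree n z z' \<Longrightarrow> agree n (weave Y y z) (weave Y y' z')"
  unfolding agree_def[of n "weave Y y z"] weave_def
  by (intro allI impI arg_cong2[of _ _ _ _ nth] interleave_cong) (auto elim: agree_mono)

text \<open>
  A prefix of the stream of length \<open>2 * n\<close> determines \<open>n\<close> rounds of reading.
\<close>

lemma weave_inj:
  assumes "y \<in> Y" "y' \<in> Y"
  shows "agree (2 * n) (weave Y y z) (weave Y y' z') \<Longrightarrow> agree n y y' \<and> agree n z z'"
proof (induction n)
  case (Suc n)
  then have IH: "agree n y y'" "agree n z z'" using agree_mono[OF Suc.prems, of "2 * n"] by auto
  define L where "L = length (interleave Y y z n)"
  have eq: "interleave Y y z n = interleave Y y' z' n" using IH by (rule interleave_cong)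
  have L: "L \<le> 2 * n" unfolding L_def by (rule length_interleave)
  have mL: "weave Y y z L = weave Y y' z' L" "weave Y y z (Suc L) = weave Y y' z' (Suc L)"
    using Suc.prems L by (auto simp: agree_def)
  have nth: "weave Y y z k = interleave Y y z (Suc n) ! k" "weave Y y' z' k = interleave Y y' z' (Suc n) ! k"
    if "k < length (interleave Y y z (Suc n))" "k < length (interleave Y y' z' (Suc n))" for k
    by (simp_all only: weave_nth[OF that(1)] weave_nth[OF that(2)])
  show ?case
  proof (cases "branches Y y n")
    case True
    then have "y n = y' n" "z n = z' n"
      using mL nth[of L] nth[of "Suc L"] eq branches_cong[OF IH(1), of Y]
      by (auto simp: L_def nth_append)
    then show ?thesis using IH by (auto simp: agree_def less_Suc_eq)
  next
    case False
    then have "z n = z' n"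
      using mL nth[of L] eq branches_cong[OF IH(1), of Y] by (auto simp: L_def nth_append)
    moreover have "y n = y' n"
    proof (rule ccontr)
      assume "y n \<noteq> y' n"
      then have "branches Y y n" unfolding branches_def using assms IH(1)
        by (metis (full_types) agree_refl agree_sym)
      then show False using False by simp
    qed
    ultimately show ?thesis using IH by (auto simp: agree_def less_Suc_eq)
  qed
qed (simp add: agree_def)

text \<open>
  Reading the stream \<open>x\<close> produces a sequence of pairs whose prefixes stabilise; the limit stays in \<open>Y\<close>
  because \<open>Y\<close> is closed.
\<close>

lemma weave_surj:
  assumes "Y \<noteq> {}" and closed: "\<And>y. (\<And>n. \<exists>w\<in>Y. agree n w y) \<Longrightarrow> y \<in> Y"
  shows "\<exists>y\<in>Y. \<exists>z. weave Y y z = x"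
proof -
  define P where "P n p \<longleftrightarrow> fst p \<in> Y \<and> (\<forall>k < length (interleave Y (fst p) (snd p) n). interleave Y (fst p) (snd p) n ! k = x k)" for n p
  define R where "R n p q \<longleftrightarrow> agree n (fst p) (fst q) \<and> agree n (snd p) (snd q)" for n and p q :: "cantor \<times> cantor"
  have "\<exists>q. P (Suc n) q \<and> R n p q" if "P n p" for p n
  proof -
    obtain y z where p: "p = (y, z)" by fastforce
    have y: "y \<in> Y" "\<And>k. k < length (interleave Y y z n) \<Longrightarrow> interleave Y y z n ! k = x k"
      using that by (auto simp: P_def p)
    define L where "L = length (interleave Y y z n)"
    define y' where "y' = (if branches Y y n then SOME w. w \<in> Y \<and> agree n w y \<and> w n = x L else y)"
    \<comment> \<open>In round \<open>n\<close> the next bits of \<open>x\<close> are read into \<open>y\<close> (where there is a choice) and \<open>z\<close>.\<close>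
    define z' where "z' = z(n := x (if branches Y y n then Suc L else L))"
    have "y' \<in> Y \<and> agree n y' y \<and> (branches Y y n \<longrightarrow> y' n = x L)"
    proof (cases "branches Y y n")
      case True
      then have "\<exists>w. w \<in> Y \<and> agree n w y \<and> w n = x L" unfolding branches_def by blast
      from someI_ex[OF this] show ?thesis using True by (simp add: y'_def)
    qed (use y in \<open>simp add: y'_def\<close>)
    then have y': "y' \<in> Y" "agree n y y'" "branches Y y n \<Longrightarrow> y' n = x L" using agree_sym by auto
    have z': "agree n z z'" by (simp add: z'_def agree_def)
    have "interleave Y y' z' (Suc n) = interleave Y y z n @ (if branches Y y n then [x L, x (Suc L)] else [x L])"
      using interleave_cong[OF y'(2) z', of Y] branches_cong[OF y'(2), of Y] y'(3) by (auto simp: z'_def)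
    then have "P (Suc n) (y', z')" using y y'(1) unfolding P_def
      by (auto simp: nth_append L_def[symmetric] less_Suc_eq nth_Cons')
    then show ?thesis using y'(2) z' by (intro exI[of _ "(y', z')"]) (simp add: R_def p)
  qed
  moreover have "\<exists>p. P 0 p" using assms(1) by (auto simp: P_def)
  ultimately obtain p where p: "\<And>n. P n (p n)" "\<And>n. R n (p n) (p (Suc n))"
    using dependent_nat_choice[of P R] by metis
  have R: "R n (p n) (p m)" if "n \<le> m" for n m
    using that by (induction rule: dec_induct)
      (use p(2) in \<open>auto simp: R_def intro: agree_trans agree_mono less_imp_le\<close>)
  define y where "y i = fst (p (Suc i)) i" for i
  define z where "z i = snd (p (Suc i)) i" for i
  have ag: "agree n (fst (p n)) y" "agree n (snd (p n)) z" for n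
    using R by (auto simp: agree_def R_def y_def z_def Suc_le_eq)
  have "y \<in> Y"
  proof (rule closed)
    fix n show "\<exists>w\<in>Y. agree n w y" using ag(1)[of n] p(1)[of n] by (auto simp: P_def)
  qed
  moreover have "weave Y y z k = x k" for k
  proof -
    have "interleave Y y z (Suc k) = interleave Y (fst (p (Suc k))) (snd (p (Suc k))) (Suc k)"
      using ag[of "Suc k"] by (intro interleave_cong) (auto intro: agree_sym)
    then show ?thesis using p(1)[of "Suc k"] length_interleave(1)[of "Suc k" Y y z]
      unfolding weave_def P_def by simp
  qed
  ultimately show ?thesis by blast
qed

lemma closed_times_cantor:
  assumes "Y \<noteq> {}" and closed: "\<And>y. (\<And>n. \<exists>w\<in>Y. agree n w y) \<Longrightarrow> y \<in> Y"
  shows "\<exists>p q. (\<forall>x. p x \<in> Y \<and> weave Y (p x) (q x) = x) \<and>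
    (\<forall>y\<in>Y. \<forall>z. p (weave Y y z) = y \<and> q (weave Y y z) = z) \<and>
    (\<forall>n x x'. agree (2 * n) x x' \<longrightarrow> agree n (p x) (p x') \<and> agree n (q x) (q x'))"
proof -
  have "\<exists>r. fst r \<in> Y \<and> weave Y (fst r) (snd r) = x" for x
    using weave_surj[OF assms, of x] by auto
  then obtain r where r: "\<And>x. fst (r x) \<in> Y" "\<And>x. weave Y (fst (r x)) (snd (r x)) = x" by metis
  have a: "agree n (fst (r x)) (fst (r x')) \<and> agree n (snd (r x)) (snd (r x'))" if "agree (2 * n) x x'" for n x x'
    using weave_inj[OF r(1) r(1), of n x "snd (r x)" x' "snd (r x')"] that by (simp add: r(2))
  have b: "fst (r (weave Y y z)) = y \<and> snd (r (weave Y y z)) = z" if "y \<in> Y" for y z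
    using weave_inj[OF r(1) that, of _ "weave Y y z" "snd (r (weave Y y z))" z] agree_eqI
    by (simp add: r(2)) 
  show ?thesis
    by (intro exI[of _ "\<lambda>x. fst (r x)"] exI[of _ "\<lambda>x. snd (r x)"]) (use r a b in auto)
qed

section \<open>Actions on the Cantor set from tilings\<close>

text \<open>
  The coordinates of the Cantor set are identified with triples of a column, a row and a label.  A labelling
  of the plane by natural numbers becomes a point whose bit at \<open>(i, j, a)\<close> says that cell \<open>(i, j)\<close> has
  label \<open>a\<close>, and translations become permutations of the coordinates.
\<close>

definition coord :: "int \<Rightarrow> int \<Rightarrow> nat \<Rightarrow> nat" where
  "coord i j a = prod_encode (int_encode i, prod_encode (int_encode j, a))"

definition grid_shift :: "int \<Rightarrow> int \<Rightarrow> cantor \<Rightarrow> cantor" where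
  "grid_shift k l y = (\<lambda>c. case prod_decode c of (i, r) \<Rightarrow> case prod_decode r of (j, a) \<Rightarrow>
     y (coord (int_decode i + k) (int_decode j + l) a))"

lemma coord_cases: obtains i j a where "c = coord i j a"
  unfolding coord_def by (metis int_decode_inverse prod_decode_inverse surj_pair)

lemma grid_shift_coord [simp]: "grid_shift k l y (coord i j a) = y (coord (i + k) (j + l) a)"
  by (simp add: grid_shift_def coord_def)

lemma grid_shift_add: "grid_shift k l (grid_shift k' l' y) = grid_shift (k + k') (l + l') y"
proof
  fix c obtain i j a where "c = coord i j a" by (rule coord_cases)
  then show "grid_shift k l (grid_shift k' l' y) c = grid_shift (k + k') (l + l') y c"
    by (simp add: add.assoc)
qed

lemma grid_shift_zero: "grid_shift 0 0 y = y"
proof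
  fix c obtain i j a where "c = coord i j a" by (rule coord_cases)
  then show "grid_shift 0 0 y c = y c" by simp
qed

lemma grid_shift_agree: "\<exists>m. \<forall>y y'. agree m y y' \<longrightarrow> agree n (grid_shift k l y) (grid_shift k l y')"
proof -
  define f where "f c = (case prod_decode c of (i, r) \<Rightarrow> case prod_decode r of (j, a) \<Rightarrow>
     coord (int_decode i + k) (int_decode j + l) a)" for c
  have f: "grid_shift k l y c = y (f c)" for y c
    by (simp add: grid_shift_def f_def split: prod.splits)
  have "f c < Suc (\<Sum>c<n. f c)" if "c < n" for c
    using that by (intro le_imp_less_Suc member_le_sum) auto
  then show ?thesis by (intro exI[of _ "Suc (\<Sum>c<n. f c)"]) (auto simp: agree_def f)
qed

text \<open>
  The orbit closure \<open>Y\<close> of a tiling is closed and invariant, but it may have isolated points.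
  Multiplying by a Cantor set on which nothing moves repairs this: \<open>Y\<close> times the Cantor set is again the
  Cantor set.  The label at the origin is a continuous function on it, and it satisfies the tile rule at
  every point because each window of a point of \<open>Y\<close> occurs in the tiling.
\<close>

lemma tiling_action:
  assumes "finite W" "valid_tiling W X"
  obtains act lab x0 where
    "\<And>k l. continuous_on UNIV (act k l)"
    "\<And>k l k' l' x. act k l (act k' l' x) = act (k + k') (l + l') x"
    "\<And>x. act 0 0 x = x"
    "\<And>x. (lab x, lab (act 1 0 x), lab (act 0 1 x), lab (act 1 1 x)) \<in> W"
    "\<And>i j. lab (act i j x0) = X i j"
    "\<And>x. \<exists>m. \<forall>y. agree m x y \<longrightarrow> lab y = (lab x :: nat)"
proof -
  have "finite (fst ` W)" using assms(1) by simp
  then obtain N where "\<And>a. a \<in> fst ` W \<Longrightarrow> a < N" using finite_nat_set_iff_bounded by auto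
  moreover have "X x y \<in> fst ` W" for x y using assms(2) unfolding valid_tiling_def by force
  ultimately have N: "X x y < N" for x y by blast
  define X' :: cantor where "X' = (\<lambda>c. case prod_decode c of (i, r) \<Rightarrow> case prod_decode r of (j, a) \<Rightarrow>
     X (int_decode i) (int_decode j) = a)"
  have X' [simp]: "X' (coord i j a) \<longleftrightarrow> X i j = a" for i j a by (simp add: X'_def coord_def)
  define Y where "Y = {y. \<forall>n. \<exists>k l. agree n y (grid_shift k l X')}"
  have X'Y: "X' \<in> Y"
    unfolding Y_def by (intro CollectI allI exI[of _ 0]) (simp add: grid_shift_zero)
  have closed: "y \<in> Y" if near: "\<And>n. \<exists>w\<in>Y. agree n w y" for y
    unfolding Y_def
  proof (intro CollectI allI)
    fix n
    obtain w where "w \<in> Y" "agree n w y" using near by blast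
    then show "\<exists>k l. agree n y (grid_shift k l X')" unfolding Y_def using agree_sym agree_trans by blast
  qed
  have shiftY: "grid_shift k l y \<in> Y" if y: "y \<in> Y" for y k l
    unfolding Y_def
  proof (intro CollectI allI)
    fix n
    obtain m where m: "\<And>y y'. agree m y y' \<Longrightarrow> agree n (grid_shift k l y) (grid_shift k l y')"
      using grid_shift_agree by blast
    obtain k' l' where "agree m y (grid_shift k' l' X')" using y unfolding Y_def by blast
    then show "\<exists>k' l'. agree n (grid_shift k l y) (grid_shift k' l' X')"
      using m grid_shift_add by metis
  qed
  have "Y \<noteq> {}" using X'Y by blast
  obtain p q where pq: "\<And>x. p x \<in> Y" "\<And>x. weave Y (p x) (q x) = x"
    "\<And>y z. y \<in> Y \<Longrightarrow> p (weave Y y z) = y" "\<And>y z. y \<in> Y \<Longrightarrow> q (weave Y y z) = z"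
    "\<And>n x x'. agree (2 * n) x x' \<Longrightarrow> agree n (p x) (p x')"
    "\<And>n x x'. agree (2 * n) x x' \<Longrightarrow> agree n (q x) (q x')"
    using closed_times_cantor[OF \<open>Y \<noteq> {}\<close> closed] by blast
  define act where "act k l x = weave Y (grid_shift k l (p x)) (q x)" for k l x
  have p_act: "p (act k l x) = grid_shift k l (p x)" for k l x
    unfolding act_def using pq(1,3) shiftY by simp
  have q_act: "q (act k l x) = q x" for k l x
    unfolding act_def using pq(1,4) shiftY by simp
  define symb where "symb y = (LEAST a. y (coord 0 0 a))" for y :: cantor
  \<comment> \<open>The window of four cells at the origin of a point of \<open>Y\<close> is a window of \<open>X\<close>.\<close>
  have local: "\<exists>k l. \<forall>i\<in>{0,1}. \<forall>j\<in>{0,1}. symb (grid_shift i j y) = X (i + k) (j + l) \<and>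
     y (coord i j (X (i + k) (j + l)))" if inY: "y \<in> Y" for y
  proof -
    let ?C = "(\<lambda>(i, j, a). coord i j a) ` ({0,1} \<times> {0,1} \<times> {..<N})"
    have "finite ?C" by simp
    then obtain n where n: "\<forall>c\<in>?C. c < n" using finite_nat_set_iff_bounded by blast
    obtain k l where kl: "agree n y (grid_shift k l X')" using inY unfolding Y_def by blast
    have y: "y (coord i j a) \<longleftrightarrow> X (i + k) (j + l) = a" if "i \<in> {0,1}" "j \<in> {0,1}" "a < N" for i j a
    proof -
      have "coord i j a < n" using that by (intro n[rule_format] image_eqI[of _ _ "(i, j, a)"]) auto
      then show ?thesis using kl by (simp add: agree_def)
    qed
    have "symb (grid_shift i j y) = X (i + k) (j + l)" if "i \<in> {0,1}" "j \<in> {0,1}" for i j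
      unfolding symb_def
    proof (rule Least_equality)
      show "grid_shift i j y (coord 0 0 (X (i + k) (j + l)))" using y that N by simp
      show "X (i + k) (j + l) \<le> a" if "grid_shift i j y (coord 0 0 a)" for a
      proof (rule ccontr)
        assume "\<not> X (i + k) (j + l) \<le> a"
        moreover from this have "a < N" using N[of "i + k" "j + l"] by linarith
        ultimately show False using that y[of i j a] \<open>i \<in> _\<close> \<open>j \<in> _\<close> by auto
      qed
    qed
    then show ?thesis
      by (intro exI[of _ k] exI[of _ l] ballI conjI) (simp_all only: y N simp_thms)
  qed
  have symb_cont: "\<exists>m. \<forall>y'\<in>Y. agree m y y' \<longrightarrow> symb y' = symb y" if "y \<in> Y" for y
  proof -
    have "\<exists>a. y (coord 0 0 a)" using local[OF that] by fastforce
    then have y: "y (coord 0 0 (symb y))" "\<And>a. a < symb y \<Longrightarrow> \<not> y (coord 0 0 a)"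
      unfolding symb_def by (auto intro: LeastI_ex dest: not_less_Least)
    obtain m where m: "\<And>c. c \<in> coord 0 0 ` {..symb y} \<Longrightarrow> c < m"
      using finite_nat_set_iff_bounded[of "coord 0 0 ` {..symb y}"] by auto
    have "symb y' = symb y" if "agree m y y'" for y'
      unfolding symb_def[of y']
    proof (rule Least_equality)
      show "y' (coord 0 0 (symb y))" using that m y(1) by (auto simp: agree_def)
      show "symb y \<le> a" if "y' (coord 0 0 a)" for a
        using that \<open>agree m y y'\<close> m[of "coord 0 0 a"] y(2)[of a] by (force simp: agree_def)
    qed
    then show ?thesis by blast
  qed
  show ?thesis
  proof (rule that[of act "\<lambda>x. symb (p x)" "weave Y X' (\<lambda>_. False)"])
    show "continuous_on UNIV (act k l)" for k l
      unfolding continuous_cantor_iff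
    proof (intro allI)
      fix x n
      obtain m where m: "\<And>y y'. agree m y y' \<Longrightarrow> agree n (grid_shift k l y) (grid_shift k l y')"
        using grid_shift_agree by blast
      have "agree n (act k l x) (act k l y)" if "agree (2 * (m + n)) x y" for y
        unfolding act_def
      proof (rule weave_agree)
        show "agree n (grid_shift k l (p x)) (grid_shift k l (p y))"
          using that by (intro m pq(5)) (auto elim: agree_mono)
        show "agree n (q x) (q y)" using that by (intro pq(6)) (auto elim: agree_mono)
      qed
      then show "\<exists>m. \<forall>y. agree m x y \<longrightarrow> agree n (act k l x) (act k l y)" by blast
    qed
    show "act k l (act k' l' x) = act (k + k') (l + l') x" for k l k' l' x
      using p_act q_act by (simp add: act_def[of k l] act_def[of "k + k'"] grid_shift_add)
    show "act 0 0 x = x" for x by (simp add: act_def grid_shift_zero pq)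
    show "(symb (p x), symb (p (act 1 0 x)), symb (p (act 0 1 x)), symb (p (act 1 1 x))) \<in> W" for x
    proof -
      obtain k l where "\<And>i j. i \<in> {0,1} \<Longrightarrow> j \<in> {0,1} \<Longrightarrow> symb (grid_shift i j (p x)) = X (i + k) (j + l)"
        using local[OF pq(1)[of x]] by blast
      from this[of 0 0] this[of 0 1] this[of 1 0] this[of 1 1] show ?thesis
        using assms(2)[unfolded valid_tiling_def, rule_format, of k l]
        by (simp add: p_act grid_shift_zero add.commute)
    qed
    show "symb (p (act i j (weave Y X' (\<lambda>_. False)))) = X i j" for i j
      unfolding p_act pq(3)[OF X'Y] symb_def by (rule Least_equality) auto
    show "\<exists>m. \<forall>y. agree m x y \<longrightarrow> symb (p y) = symb (p x)" for x
      using symb_cont[OF pq(1)[of x]] pq(1,5) by blast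
  qed
qed

section \<open>Dense conjugacy classes and clopen tilings\<close>

text \<open>
  Only the first two coordinate directions of the lattice are used.
\<close>

definition plane_vec :: "nat \<Rightarrow> int \<Rightarrow> int \<Rightarrow> nat \<Rightarrow> int" where
  "plane_vec d i j = (\<lambda>k\<in>{..<d}. if k = 0 then i else if k = 1 then j else 0)"

lemma plane_vec_carrier: "plane_vec d i j \<in> carrier (int_lattice d)"
  by (simp add: plane_vec_def int_lattice_def)

lemma plane_vec_mult: "plane_vec d i j \<otimes>\<^bsub>int_lattice d\<^esub> plane_vec d k l = plane_vec d (i + k) (j + l)"
  by (auto simp: plane_vec_def int_lattice_def fun_eq_iff restrict_def)

lemma plane_vec_one: "plane_vec d 0 0 = \<one>\<^bsub>int_lattice d\<^esub>"
  by (auto simp: plane_vec_def int_lattice_def fun_eq_iff restrict_def)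

lemma action_plane_vec:
  assumes "\<phi> \<in> topspace (action_space d)"
  shows "\<phi> (plane_vec d i j) (\<phi> (plane_vec d k l) x) = \<phi> (plane_vec d (i + k) (j + l)) x" "\<phi> (plane_vec d 0 0) x = x"
proof -
  have h: "\<phi> \<in> hom (int_lattice d) homeo_group" using assms by (simp add: topspace_action_space)
  from hom_mult[OF h plane_vec_carrier plane_vec_carrier, of i j k l]
  have "\<phi> (plane_vec d (i + k) (j + l)) = \<phi> (plane_vec d i j) \<circ> \<phi> (plane_vec d k l)"
    by (simp add: plane_vec_mult homeo_group_def)
  then show "\<phi> (plane_vec d i j) (\<phi> (plane_vec d k l) x) = \<phi> (plane_vec d (i + k) (j + l)) x" by simp
  have "group (int_lattice d)" by (simp add: int_lattice_def)
  then have "\<phi> (\<one>\<^bsub>int_lattice d\<^esub>) = \<one>\<^bsub>homeo_group\<^esub>"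
    using h group_homeo_group hom_one by blast
  then show "\<phi> (plane_vec d 0 0) x = x" by (simp add: plane_vec_one homeo_group_def)
qed

lemma action_plane_vec_continuous:
  assumes "\<phi> \<in> topspace (action_space d)"
  shows "continuous_on UNIV (\<phi> (plane_vec d i j))"
proof -
  have "\<phi> \<in> hom (int_lattice d) homeo_group" using assms by (simp add: topspace_action_space)
  then have "\<phi> (plane_vec d i j) \<in> carrier homeo_group" using plane_vec_carrier by (rule hom_in_carrier)
  then show ?thesis by (auto simp: homeo_group_def homeomorphism_def)
qed

lemma homeo_dist_agree:
  assumes "homeo_dist f g < (1/2) ^ n" shows "agree n (f x) (g x)"
proof -
  have "cantor_dist (f x) (g x) \<le> homeo_dist f g"
    unfolding homeo_dist_def
    by (rule cSUP_upper[OF UNIV_I bdd_aboveI[of _ 1]]) (use cantor_dist_bounds in auto)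
  then show ?thesis using assms by (simp add: agree_def cantor_dist_less_iff[symmetric] less_imp_le
        cantor_dist_less_iff[THEN iffD1, rule_format, OF le_less_trans])
qed

text \<open>
  Density, used with the basic open neighbourhood of \<open>\<psi>\<close> given by finitely many group elements and one
  uniform distance.
\<close>

lemma dense_conjugate_approximates:
  assumes dense: "action_space d closure_of conjugacy_class d \<phi> = topspace (action_space d)"
    and \<psi>: "\<psi> \<in> topspace (action_space d)"
    and F: "finite F" "F \<subseteq> carrier (int_lattice d)"
  obtains \<pi> \<pi>' where "homeomorphism UNIV UNIV \<pi> \<pi>'"
    "\<And>u x. u \<in> F \<Longrightarrow> agree n (\<pi> (\<phi> u (\<pi>' x))) (\<psi> u x)"
proof -
  interpret Metric_space "carrier homeo_group" homeo_dist by (rule Metric_space_homeo_dist)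
  let ?P = "product_topology (\<lambda>_. homeo_topology) (carrier (int_lattice d))"
  have hom: "\<psi> u \<in> carrier homeo_group" if "u \<in> carrier (int_lattice d)" for u
  proof -
    have "\<psi> \<in> hom (int_lattice d) homeo_group" using \<psi> by (simp add: topspace_action_space)
    then show ?thesis using that by (rule hom_in_carrier)
  qed
  define U where "U = topspace (action_space d) \<inter>
    (\<Inter>u\<in>F. {\<theta> \<in> topspace (action_space d). \<theta> u \<in> mball (\<psi> u) ((1/2) ^ n)})"
  have "openin (action_space d) {\<theta> \<in> topspace (action_space d). \<theta> u \<in> mball (\<psi> u) ((1/2) ^ n)}"
    if "u \<in> F" for u
  proof (rule openin_continuous_map_preimage)
    show "continuous_map (action_space d) homeo_topology (\<lambda>\<theta>. \<theta> u)"
      unfolding action_space_def using that F(2)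
      by (intro continuous_map_from_subtopology continuous_map_product_projection) auto
    show "openin homeo_topology (mball (\<psi> u) ((1/2) ^ n))"
      unfolding homeo_topology_def by (rule openin_mball)
  qed
  then have "openin (action_space d) U"
    unfolding U_def using F(1)
    by (cases "F = {}") (auto intro!: openin_Int openin_INT2)
  moreover have "\<psi> \<in> U"
    unfolding U_def using \<psi> F(2) hom by (auto simp: in_mball)
  moreover have "\<psi> \<in> action_space d closure_of conjugacy_class d \<phi>" using dense \<psi> by simp
  ultimately obtain \<theta> where \<theta>: "\<theta> \<in> conjugacy_class d \<phi>" "\<theta> \<in> U"
    unfolding in_closure_of by blast
  obtain \<pi> \<pi>' where h: "homeomorphism UNIV UNIV \<pi> \<pi>'"
    and \<theta>': "\<theta> = (\<lambda>u\<in>carrier (int_lattice d). \<pi> \<circ> \<phi> u \<circ> \<pi>')"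
    using \<theta>(1) unfolding conjugacy_class_def by blast
  have "agree n (\<pi> (\<phi> u (\<pi>' x))) (\<psi> u x)" if u: "u \<in> F" for u x
  proof -
    have "homeo_dist (\<psi> u) (\<theta> u) < (1/2) ^ n" using \<theta>(2) u by (auto simp: U_def in_mball)
    then have "agree n (\<psi> u x) (\<theta> u x)" by (rule homeo_dist_agree)
    moreover have "u \<in> carrier (int_lattice d)" using F(2) u by blast
    ultimately show ?thesis by (simp add: \<theta>' agree_sym)
  qed
  then show ?thesis using h that by blast
qed

definition word_stream :: "bool list \<Rightarrow> cantor" where
  "word_stream w i = (if i < length w then w ! i else False)"

definition prefix_word :: "nat \<Rightarrow> cantor \<Rightarrow> bool list" where
  "prefix_word m x = map x [0..<m]"

lemma length_prefix_word [simp]: "length (prefix_word m x) = m"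
  by (simp add: prefix_word_def)

abbreviation word_cylinder :: "bool list \<Rightarrow> cantor set" where
  "word_cylinder w \<equiv> cylinder (map Some w)"

lemma word_cylinder_iff: "x \<in> word_cylinder w \<longleftrightarrow> prefix_word (length w) x = w"
proof -
  have "x \<in> word_cylinder w \<longleftrightarrow> (\<forall>i<length w. x i = w ! i)" by (auto simp: cylinder_def)
  also have "\<dots> \<longleftrightarrow> prefix_word (length w) x = w"
    unfolding list_eq_iff_nth_eq[of _ w] by (auto simp: prefix_word_def)
  finally show ?thesis .
qed

lemma word_cylinder_agree: "x \<in> word_cylinder w \<Longrightarrow> agree (length w) x (word_stream w)"
  by (auto simp: cylinder_def agree_def word_stream_def)

lemma word_stream_in: "word_stream w \<in> word_cylinder w"
  by (auto simp: cylinder_def word_stream_def)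

text \<open>
  A labelling of the words of length \<open>m\<close> is a clopen partition of the Cantor set, and following the orbit
  of a point \<open>y\<close> gives a labelling of the plane: cell \<open>(i, j)\<close> gets the label of
  \<open>\<phi> (plane_vec d (-i) (-j)) y\<close>.  The predicate says that the four labels of a window are always in \<open>W\<close>, and that
  for \<open>y\<close> in the cylinder of \<open>p\<close> the seed conditions \<open>Q\<close> hold.  Every violation is excluded by a
  \<open>\<phi>\<close>-disjoint sequence, and a cylinder is never empty, so a clopen tiling is a finite object that can be
  verified by enumerating the \<open>\<phi>\<close>-disjoint sequences.
\<close>

definition clopen_tiling ::
  "nat \<Rightarrow> ((nat \<Rightarrow> int) \<Rightarrow> cantor \<Rightarrow> cantor) \<Rightarrow> (nat \<times> nat \<times> nat \<times> nat) set \<Rightarrow> (nat \<times> nat set) list \<Rightarrow>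
   nat \<Rightarrow> (bool list \<Rightarrow> nat) \<Rightarrow> bool list \<Rightarrow> bool" where
  "clopen_tiling d \<phi> W Q m lab p \<longleftrightarrow> length p = m \<and>
    (\<forall>c1 c2 c3 c4. length c1 = m \<and> length c2 = m \<and> length c3 = m \<and> length c4 = m \<longrightarrow>
      (lab c1, lab c2, lab c3, lab c4) \<in> W \<or>
      disjoint_seq \<phi> [(map Some c1, plane_vec d 0 0), (map Some c2, plane_vec d 1 0),
        (map Some c3, plane_vec d 0 1), (map Some c4, plane_vec d 1 1)]) \<and>
    (\<forall>(v, A)\<in>set Q. \<forall>c. length c = m \<longrightarrow> lab c \<in> A \<or>
      disjoint_seq \<phi> [(map Some p, plane_vec d 0 0), (map Some c, plane_vec d (int v) 0)])"

text \<open>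
  The orbit of a point of the cylinder of \<open>p\<close> is a seeded tiling.
\<close>

lemma clopen_tiling_sound:
  assumes \<phi>: "\<phi> \<in> topspace (action_space d)" and t: "clopen_tiling d \<phi> W Q m lab p"
  shows "\<exists>X. valid_tiling W X \<and> seeded Q X"
proof -
  define y where "y = word_stream p"
  define X where "X i j = lab (prefix_word m (\<phi> (plane_vec d (-i) (-j)) y))" for i j
  have cyl: "x \<in> word_cylinder (prefix_word m x)" for x by (simp add: word_cylinder_iff)
  have img: "\<phi> (plane_vec d (-i) (-j)) y \<in> \<phi> (plane_vec d k l) ` word_cylinder (prefix_word m (\<phi> (plane_vec d (-(i + k)) (-(j + l))) y))"
    for i j k l
    by (rule image_eqI[OF _ cyl]) (simp add: action_plane_vec[OF \<phi>])
  have "valid_tiling W X"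
    unfolding valid_tiling_def
  proof (intro allI)
    fix i j
    let ?c = "\<lambda>k l. prefix_word m (\<phi> (plane_vec d (-(i + k)) (-(j + l))) y)"
    have "\<not> disjoint_seq \<phi> [(map Some (?c 0 0), plane_vec d 0 0), (map Some (?c 1 0), plane_vec d 1 0),
        (map Some (?c 0 1), plane_vec d 0 1), (map Some (?c 1 1), plane_vec d 1 1)]"
      using img[of i j 0 0] img[of i j 1 0] img[of i j 0 1] img[of i j 1 1]
      unfolding disjoint_seq_def by auto
    then have "(lab (?c 0 0), lab (?c 1 0), lab (?c 0 1), lab (?c 1 1)) \<in> W"
      using t unfolding clopen_tiling_def by (meson length_prefix_word)
    then show "(X i j, X (i + 1) j, X i (j + 1), X (i + 1) (j + 1)) \<in> W"
      by (simp add: X_def)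
  qed
  moreover have "seeded Q X"
    unfolding seeded_def
  proof clarify
    fix v A assume vA: "(v, A) \<in> set Q"
    let ?c = "prefix_word m (\<phi> (plane_vec d (- int v) 0) y)"
    have "y \<in> \<phi> (plane_vec d 0 0) ` word_cylinder p"
      using word_stream_in[of p] action_plane_vec(2)[OF \<phi>] by (metis image_eqI y_def)
    moreover have "y \<in> \<phi> (plane_vec d (int v) 0) ` word_cylinder ?c"
      using img[of 0 0 "int v" 0] action_plane_vec(2)[OF \<phi>] by simp
    ultimately have "\<not> disjoint_seq \<phi> [(map Some p, plane_vec d 0 0), (map Some ?c, plane_vec d (int v) 0)]"
      unfolding disjoint_seq_def by auto
    moreover have "\<forall>(v, A)\<in>set Q. \<forall>c. length c = m \<longrightarrow> lab c \<in> A \<or>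
        disjoint_seq \<phi> [(map Some p, plane_vec d 0 0), (map Some c, plane_vec d (int v) 0)]"
      using t unfolding clopen_tiling_def by blast
    ultimately have "lab ?c \<in> A" using vA length_prefix_word by blast
    then show "X (int v) 0 \<in> A" by (simp add: X_def)
  qed
  ultimately show ?thesis by blast
qed

lemma cyl_preimage:
  assumes "\<phi> \<in> topspace (action_space d)" "y \<in> \<phi> (plane_vec d i j) ` C"
  shows "\<phi> (plane_vec d (-i) (-j)) y \<in> C"
  using assms(2) action_plane_vec[OF assms(1)] by auto

text \<open>
  A seeded tiling yields an action \<open>\<psi>\<close> with a continuous labelling that obeys the rules.
  A conjugate of \<open>\<phi>\<close> that is close enough to \<open>\<psi>\<close> at the finitely many group elements involved
  sees the same labels, and pulling the labelling back by the conjugating homeomorphism gives one for \<open>\<phi>\<close>.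
\<close>

lemma clopen_tiling_complete:
  assumes "2 \<le> d" and \<phi>: "\<phi> \<in> topspace (action_space d)"
    and dense: "action_space d closure_of conjugacy_class d \<phi> = topspace (action_space d)"
    and "finite W" "valid_tiling W X" "seeded Q X"
  shows "\<exists>m lab p. clopen_tiling d \<phi> W Q m lab p"
proof -
  obtain act lab x0 where act:
    "\<And>k l. continuous_on UNIV (act k l)"
    "\<And>k l k' l' x. act k l (act k' l' x) = act (k + k') (l + l') x"
    "\<And>x. act 0 0 x = x"
    "\<And>x. (lab x, lab (act 1 0 x), lab (act 0 1 x), lab (act 1 1 x)) \<in> W"
    "\<And>i j. lab (act i j x0) = X i j"
    "\<And>x. \<exists>m. \<forall>y. agree m x y \<longrightarrow> lab y = (lab x :: nat)"
    using tiling_action[OF assms(4,5)] by blast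
  \<comment> \<open>The minus signs match the convention that cell \<open>u\<close> shows the label after acting by \<open>-u\<close>.\<close>
  define \<psi> where "\<psi> = (\<lambda>u\<in>carrier (int_lattice d). act (- u 0) (- u 1))"
  have homeo: "homeomorphism UNIV UNIV (act k l) (act (-k) (-l))" for k l
  proof -
    have "act k l (act (-k) (-l) x) = x" "act (-k) (-l) (act k l x) = x" for x
      by (simp_all add: act(2,3))
    then show ?thesis unfolding homeomorphism_def using act(1) by (metis surjI)
  qed
  have \<psi>: "\<psi> \<in> topspace (action_space d)"
    unfolding topspace_action_space
  proof
    show "\<psi> \<in> hom (int_lattice d) homeo_group"
    proof (rule homI)
      fix u assume "u \<in> carrier (int_lattice d)"
      then show "\<psi> u \<in> carrier homeo_group"
        using homeo by (auto simp: \<psi>_def homeo_group_def)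
    next
      fix u v assume uv: "u \<in> carrier (int_lattice d)" "v \<in> carrier (int_lattice d)"
      interpret group "int_lattice d" by (simp add: int_lattice_def)
      have uv': "u \<otimes>\<^bsub>int_lattice d\<^esub> v \<in> carrier (int_lattice d)" using uv by (rule m_closed)
      have "(u \<otimes>\<^bsub>int_lattice d\<^esub> v) k = u k + v k" if "k < d" for k
        using that by (simp add: int_lattice_def)
      then show "\<psi> (u \<otimes>\<^bsub>int_lattice d\<^esub> v) = \<psi> u \<otimes>\<^bsub>homeo_group\<^esub> \<psi> v"
        using uv uv' \<open>2 \<le> d\<close> by (auto simp: \<psi>_def homeo_group_def act(2) fun_eq_iff)
    qed
    show "\<psi> \<in> extensional (carrier (int_lattice d))" by (simp add: \<psi>_def)
  qed
  have \<psi>_vec: "\<psi> (plane_vec d (-i) (-j)) = act i j" for i j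
  proof -
    have "\<psi> (plane_vec d (-i) (-j)) = act (- plane_vec d (-i) (-j) 0) (- plane_vec d (-i) (-j) 1)"
      by (simp add: \<psi>_def plane_vec_carrier)
    then show ?thesis using \<open>2 \<le> d\<close> by (simp add: plane_vec_def)
  qed
  obtain n where n: "\<And>x y. agree n x y \<Longrightarrow> lab x = lab y"
    using locally_constant_uniform[OF act(6)] by metis
  \<comment> \<open>The cells whose labels matter: the window of the tile rule and the seed cells.\<close>
  define I where "I = {(0,0), (1,0), (0,1), (1,1)} \<union> (\<lambda>(v, A). (int v, 0::int)) ` set Q"
  have "finite I" unfolding I_def by simp
  then obtain \<pi> \<pi>' where \<pi>: "homeomorphism UNIV UNIV \<pi> \<pi>'"
    and approx: "\<And>u x. u \<in> (\<lambda>(i, j). plane_vec d (-i) (-j)) ` I \<Longrightarrow> agree n (\<pi> (\<phi> u (\<pi>' x))) (\<psi> u x)"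
    using dense_conjugate_approximates[OF dense \<psi>, of "(\<lambda>(i, j). plane_vec d (-i) (-j)) ` I" n] plane_vec_carrier
    by (smt (verit, del_insts) finite_imageI image_subsetI split_beta)
  have \<pi>': "\<pi>' (\<pi> x) = x" "\<pi> (\<pi>' x) = x" for x using \<pi> by (auto simp: homeomorphism_def)
  have transfer: "lab (\<pi> (\<phi> (plane_vec d (-i) (-j)) x)) = lab (act i j (\<pi> x))" if "(i, j) \<in> I" for i j x
    using n[OF approx[of "plane_vec d (-i) (-j)" "\<pi> x"]] that by (force simp: \<pi>' \<psi>_vec)
  have lc: "\<exists>m. \<forall>y. agree m x y \<longrightarrow> lab (\<pi> (\<phi> (plane_vec d (-i) (-j)) y)) = lab (\<pi> (\<phi> (plane_vec d (-i) (-j)) x))" for i j x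
  proof -
    have "continuous_on UNIV (\<pi> \<circ> \<phi> (plane_vec d (-i) (-j)))"
      using \<pi> by (intro continuous_on_compose action_plane_vec_continuous[OF \<phi>])
        (auto simp: homeomorphism_def intro: continuous_on_subset)
    then show ?thesis unfolding continuous_cantor_iff using n by (metis comp_apply)
  qed
  have "\<exists>m. \<forall>x y. agree m x y \<longrightarrow> lab (\<pi> (\<phi> (plane_vec d (-i) (-j)) x)) = lab (\<pi> (\<phi> (plane_vec d (-i) (-j)) y))" for i j
    using locally_constant_uniform[OF lc[of _ i j]] by metis
  then obtain M where M: "\<And>i j x y. agree (M i j) x y \<Longrightarrow>
      lab (\<pi> (\<phi> (plane_vec d (-i) (-j)) x)) = lab (\<pi> (\<phi> (plane_vec d (-i) (-j)) y))" by metis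
  define m where "m = (\<Sum>(i,j)\<in>I. M i j)"
  have m: "M i j \<le> m" if "(i, j) \<in> I" for i j
    unfolding m_def using \<open>finite I\<close> that member_le_sum[of "(i, j)" I "\<lambda>(i, j). M i j"] by auto
  have I00: "(0, 0) \<in> I" by (simp add: I_def)
  define lab' where "lab' w = lab (\<pi> (word_stream w))" for w
  have lab': "lab (\<pi> x) = lab' w" if "x \<in> word_cylinder w" "length w = m" for x w
    using M[of 0 0 x "word_stream w"] word_cylinder_agree[OF that(1)] m[OF I00] that(2)
    by (auto simp: lab'_def action_plane_vec(2)[OF \<phi>] intro: agree_mono)
  define p where "p = prefix_word m (\<pi>' x0)"
  have "clopen_tiling d \<phi> W Q m lab' p"
    unfolding clopen_tiling_def
  proof (intro conjI allI impI ballI)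
    show "length p = m" by (simp add: p_def)
  next
    fix c1 c2 c3 c4 :: "bool list"
    assume len: "length c1 = m \<and> length c2 = m \<and> length c3 = m \<and> length c4 = m"
    show "(lab' c1, lab' c2, lab' c3, lab' c4) \<in> W \<or>
      disjoint_seq \<phi> [(map Some c1, plane_vec d 0 0), (map Some c2, plane_vec d 1 0),
        (map Some c3, plane_vec d 0 1), (map Some c4, plane_vec d 1 1)]"
    proof (rule disjCI)
      assume "\<not> disjoint_seq \<phi> [(map Some c1, plane_vec d 0 0), (map Some c2, plane_vec d 1 0),
        (map Some c3, plane_vec d 0 1), (map Some c4, plane_vec d 1 1)]"
      then obtain y where y: "y \<in> \<phi> (plane_vec d 0 0) ` word_cylinder c1" "y \<in> \<phi> (plane_vec d 1 0) ` word_cylinder c2"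
        "y \<in> \<phi> (plane_vec d 0 1) ` word_cylinder c3" "y \<in> \<phi> (plane_vec d 1 1) ` word_cylinder c4"
        unfolding disjoint_seq_def by auto
      have "lab' c1 = lab (act 0 0 (\<pi> y))" "lab' c2 = lab (act 1 0 (\<pi> y))"
        "lab' c3 = lab (act 0 1 (\<pi> y))" "lab' c4 = lab (act 1 1 (\<pi> y))"
        using y[THEN cyl_preimage[OF \<phi>]] len
        by (auto simp: transfer[symmetric] I_def intro!: lab'[symmetric])
      then show "(lab' c1, lab' c2, lab' c3, lab' c4) \<in> W" using act(3,4)[of "\<pi> y"] by simp
    qed
  next
    fix vA assume vA: "vA \<in> set Q"
    obtain v A where [simp]: "vA = (v, A)" by fastforce
    have vI: "(int v, 0) \<in> I" using vA by (force simp: I_def)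
    have "lab' c \<in> A" if c: "length c = m"
      and nd: "\<not> disjoint_seq \<phi> [(map Some p, plane_vec d 0 0), (map Some c, plane_vec d (int v) 0)]" for c
    proof -
      obtain y where y: "y \<in> \<phi> (plane_vec d 0 0) ` word_cylinder p" "y \<in> \<phi> (plane_vec d (int v) 0) ` word_cylinder c"
        using nd unfolding disjoint_seq_def by auto
      have "prefix_word m y = prefix_word m (\<pi>' x0)"
        using y(1) by (auto simp: action_plane_vec(2)[OF \<phi>] word_cylinder_iff p_def)
      then have "agree m y (\<pi>' x0)" by (simp add: prefix_word_def agree_def)
      then have "lab (\<pi> (\<phi> (plane_vec d (- int v) (-0)) y)) = lab (\<pi> (\<phi> (plane_vec d (- int v) (-0)) (\<pi>' x0)))"
        using m[OF vI] by (intro M) (auto intro: agree_mono)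
      also have "\<dots> = X (int v) 0" using transfer[OF vI] by (simp add: \<pi>' act(5))
      also have "X (int v) 0 \<in> A" using assms(6) vA by (auto simp: seeded_def)
      finally show ?thesis using lab'[OF cyl_preimage[OF \<phi> y(2)] c] by simp
    qed
    then show "case vA of (v, A) \<Rightarrow> \<forall>c. length c = m \<longrightarrow> lab' c \<in> A \<or>
        disjoint_seq \<phi> [(map Some p, plane_vec d 0 0), (map Some c, plane_vec d (int v) 0)]"
      by auto
  qed
  then show ?thesis by blast
qed

section \<open>Enumerability of clopen tilings\<close>

definition word_code :: "bool list \<Rightarrow> nat" where
  "word_code w = list_encode (map (\<lambda>b. if b then 2 else 1) w)"

lemma pattern_code_word: "pattern_code (map Some w) = word_code w"
  by (simp add: pattern_code_def word_code_def comp_def)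

lemma inj_word_code: "inj word_code"
proof -
  have "inj (pattern_code \<circ> map Some)"
    using inj_pattern_code by (intro inj_compose) simp_all
  then show ?thesis by (simp add: comp_def pattern_code_word)
qed

text \<open>
  Being the code of a word of length \<open>m\<close>, as a primitive recursive condition.  Codes of such words are
  bounded by the code of the word of \<open>m\<close> ones, which turns quantifiers over words into bounded quantifiers.
\<close>

definition is_word :: "nat \<Rightarrow> nat \<Rightarrow> bool" where
  "is_word m c \<longleftrightarrow> cdrop m c = 0 \<and> (\<forall>i<m. cdrop i c \<noteq> 0 \<and> (cnth i c = 1 \<or> cnth i c = 2))"

lemma is_word_iff: "is_word m c \<longleftrightarrow> (\<exists>w. length w = m \<and> c = word_code w)"
proof
  assume c: "is_word m c"
  define l where "l = list_decode c"
  have cl: "c = list_encode l" by (simp add: l_def)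
  have "length l \<le> m" using c by (simp add: cl is_word_def)
  moreover have "i < length l" if "i < m" for i using c that by (auto simp: cl is_word_def not_le)
  ultimately have len: "length l = m" by (metis le_neq_implies_less less_irrefl)
  have bit: "l ! i = 1 \<or> l ! i = 2" if "i < m" for i using c that len by (auto simp: cl is_word_def)
  have "l = map (\<lambda>b. if b then 2 else 1) (map (\<lambda>a. a = 2) l)"
    using bit len by (intro nth_equalityI) auto
  then show "\<exists>w. length w = m \<and> c = word_code w"
    using len by (intro exI[of _ "map (\<lambda>a. a = 2) l"]) (simp add: word_code_def cl)
qed (auto simp: is_word_def word_code_def)

lemma PRP_is_word: "PR F \<Longrightarrow> PR G \<Longrightarrow> PRP (\<lambda>e. is_word (F e) (G e))"
proof -
  have "PRP (\<lambda>z. is_word (pfst z) (psnd z))"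
    unfolding is_word_def by (intro PR_intros PR_cdrop PR_cnth)
  then show "PR F \<Longrightarrow> PR G \<Longrightarrow> PRP (\<lambda>e. is_word (F e) (G e))" by (rule PRP_subst2)
qed

definition word_bound :: "nat \<Rightarrow> nat" where
  "word_bound m = Suc (rec_nat 0 (\<lambda>_ y. ccons 2 y) m)"

lemma PR_word_bound: "PR F \<Longrightarrow> PR (\<lambda>e. word_bound (F e))"
  unfolding word_bound_def by (intro PR_rec PR_intros PR_ccons)

lemma prod_encode_mono: "a \<le> a' \<Longrightarrow> b \<le> b' \<Longrightarrow> prod_encode (a, b) \<le> prod_encode (a', b')"
  unfolding prod_encode_def
  using strict_mono_less_eq[OF triangle_strict_mono, of "a + b" "a' + b'"] by simp

lemma word_code_bound: "word_code w < word_bound (length w)"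
proof (induction w)
  case (Cons b w)
  then show ?case
    by (auto simp: word_code_def word_bound_def list_encode_Cons ccons_def pair_def less_Suc_eq_le intro: prod_encode_mono)
qed (simp add: word_code_def word_bound_def)

lemma all_words_iff:
  "(\<forall>c<word_bound m. \<not> is_word m c \<or> P c) \<longleftrightarrow> (\<forall>w. length w = m \<longrightarrow> P (word_code w))"
  unfolding is_word_iff using word_code_bound by blast

text \<open>
  The vector that carries the position of the seed depends on the input.  Its entry is nonnegative, hence its
  integer code is \<open>2 * v\<close>.
\<close>

definition axis_code :: "nat \<Rightarrow> nat \<Rightarrow> nat" where
  "axis_code d v = ccons (v + v) (list_encode (replicate (d - 1) 0))"

lemma vector_code_axis:
  assumes "2 \<le> d" shows "vector_code d (plane_vec d (int v) 0) = axis_code d v"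
proof -
  have "[0..<d] = 0 # [1..<d]" using assms by (simp add: upt_rec)
  moreover have "map (\<lambda>k. int_encode (plane_vec d (int v) 0 k)) [1..<d] = replicate (d - 1) 0"
    by (intro nth_equalityI) (auto simp: plane_vec_def int_encode_def sum_encode_def)
  moreover have "int_encode (plane_vec d (int v) 0 0) = v + v"
    using assms by (simp add: plane_vec_def int_encode_def sum_encode_def)
  ultimately show ?thesis by (simp add: vector_code_def axis_code_def list_encode_Cons)
qed

lemma PR_axis_code: "PR F \<Longrightarrow> PR (\<lambda>e. axis_code d (F e))"
  unfolding axis_code_def by (intro PR_ccons PR_add PR_const)

definition disjoint_codes :: "nat \<Rightarrow> ((nat \<Rightarrow> int) \<Rightarrow> cantor \<Rightarrow> cantor) \<Rightarrow> nat set" where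
  "disjoint_codes d \<phi> = seq_code d ` {s \<in> lists (UNIV \<times> carrier (int_lattice d)). disjoint_seq \<phi> s}"

lemma disjoint_codes_iff:
  assumes "s \<in> lists (UNIV \<times> carrier (int_lattice d))"
  shows "seq_code d s \<in> disjoint_codes d \<phi> \<longleftrightarrow> disjoint_seq \<phi> s"
  using inj_on_seq_code[of d] assms unfolding disjoint_codes_def by (auto dest: inj_onD)

definition pairs_code :: "(nat \<times> nat) list \<Rightarrow> nat" where
  "pairs_code l = list_encode (map (\<lambda>(a, b). pair a b) l)"

lemma seq_code_words:
  "seq_code d (map (\<lambda>(w, u). (map Some w, u)) l) = pairs_code (map (\<lambda>(w, u). (word_code w, vector_code d u)) l)"
  by (simp add: seq_code_def pairs_code_def pattern_code_word pair_def split_def comp_def)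

lemma PR_pairs_code:
  "PR (\<lambda>e. pairs_code [])"
  "PR F \<Longrightarrow> PR G \<Longrightarrow> PR (\<lambda>e. pairs_code (L e)) \<Longrightarrow> PR (\<lambda>e. pairs_code ((F e, G e) # L e))"
  unfolding pairs_code_def by (auto simp: list_encode_Cons intro: PR_const PR_ccons PR_pair)

text \<open>
  The two parts of \<^const>\<open>clopen_tiling\<close> on the level of codes.  The labelling is given by the coded list \<open>t\<close> of
  its values, indexed by the codes of words.
\<close>

definition seed_coded :: "nat \<Rightarrow> nat set \<Rightarrow> nat \<Rightarrow> nat \<Rightarrow> nat \<Rightarrow> nat \<Rightarrow> nat set \<Rightarrow> bool" where
  "seed_coded d D m t p v A \<longleftrightarrow> (\<forall>c<word_bound m. \<not> is_word m c \<or>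
     cnth c t \<in> A \<or> pairs_code [(p, axis_code d 0), (c, axis_code d v)] \<in> D)"

definition rule_coded :: "nat \<Rightarrow> nat set \<Rightarrow> nat \<Rightarrow> nat \<Rightarrow> nat set \<Rightarrow> bool" where
  "rule_coded d D m t W \<longleftrightarrow>
     (\<forall>c1<word_bound m. \<not> is_word m c1 \<or> (\<forall>c2<word_bound m. \<not> is_word m c2 \<or>
     (\<forall>c3<word_bound m. \<not> is_word m c3 \<or> (\<forall>c4<word_bound m. \<not> is_word m c4 \<or>
       pair (cnth c1 t) (pair (cnth c2 t) (pair (cnth c3 t) (cnth c4 t))) \<in> W \<or>
       pairs_code [(c1, axis_code d 0), (c2, axis_code d 1), (c3, vector_code d (plane_vec d 0 1)),
         (c4, vector_code d (plane_vec d 1 1))] \<in> D))))"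

lemma RE_seed_coded:
  assumes "RE (\<lambda>n. n \<in> D)" "finite A" "PR M" "PR T" "PR P" "PR V"
  shows "RE (\<lambda>e. seed_coded d D (M e) (T e) (P e) (V e) A)"
proof -
  have "RE (\<lambda>z. seed_coded d D (pfst z) (pfst (psnd z)) (pfst (psnd (psnd z))) (psnd (psnd (psnd z))) A)"
    unfolding seed_coded_def
    by (intro RE_ball RE_disj RE_PRP[OF PRP_not] PRP_is_word RE_PRP[OF PRP_finite[OF assms(2)]]
      RE_subst[OF assms(1)] PR_word_bound PR_cnth PR_pairs_code PR_axis_code PR_pfst PR_psnd PR_id PR_const)
  from RE_subst[OF this, of "\<lambda>e. pair (M e) (pair (T e) (pair (P e) (V e)))"] show ?thesis
    using assms(3-) by (simp add: PR_pair)
qed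

lemma RE_rule_coded:
  assumes "RE (\<lambda>n. n \<in> D)" "finite W" "PR M" "PR T"
  shows "RE (\<lambda>e. rule_coded d D (M e) (T e) W)"
proof -
  have "RE (\<lambda>z. rule_coded d D (pfst z) (psnd z) W)"
    unfolding rule_coded_def
    by (intro RE_ball RE_disj RE_PRP[OF PRP_not] PRP_is_word RE_PRP[OF PRP_finite[OF assms(2)]]
      RE_subst[OF assms(1)] PR_word_bound PR_cnth PR_pairs_code PR_axis_code PR_pair PR_pfst PR_psnd PR_id PR_const)
  from RE_subst2[OF this assms(3,4)] show ?thesis .
qed

definition quad_code :: "nat \<times> nat \<times> nat \<times> nat \<Rightarrow> nat" where
  "quad_code = (\<lambda>(a, b, c, e). pair a (pair b (pair c e)))"

lemma inj_quad_code: "inj quad_code"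
  by (auto simp: inj_def quad_code_def)

lemma clopen_tiling_coded:
  assumes "2 \<le> d"
  shows "clopen_tiling d \<phi> W Q m (\<lambda>w. cnth (word_code w) t) p \<longleftrightarrow> length p = m \<and>
    rule_coded d (disjoint_codes d \<phi>) m t (quad_code ` W) \<and>
    (\<forall>(v, A)\<in>set Q. seed_coded d (disjoint_codes d \<phi>) m t (word_code p) v A)"
proof -
  let ?D = "disjoint_codes d \<phi>"
  have words: "disjoint_seq \<phi> (map (\<lambda>(w, u). (map Some w, u)) l) \<longleftrightarrow>
      pairs_code (map (\<lambda>(w, u). (word_code w, vector_code d u)) l) \<in> ?D"
    if "\<forall>(w, u)\<in>set l. u \<in> carrier (int_lattice d)" for l
    using that unfolding seq_code_words[symmetric] by (subst disjoint_codes_iff) auto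
  have zero: "vector_code d (plane_vec d 0 0) = axis_code d 0" "vector_code d (plane_vec d 1 0) = axis_code d 1"
    using vector_code_axis[OF assms, of 0] vector_code_axis[OF assms, of 1] by simp_all
  have rule: "disjoint_seq \<phi> [(map Some c1, plane_vec d 0 0), (map Some c2, plane_vec d 1 0),
        (map Some c3, plane_vec d 0 1), (map Some c4, plane_vec d 1 1)] \<longleftrightarrow>
      pairs_code [(word_code c1, axis_code d 0), (word_code c2, axis_code d 1),
        (word_code c3, vector_code d (plane_vec d 0 1)), (word_code c4, vector_code d (plane_vec d 1 1))] \<in> ?D"
    for c1 c2 c3 c4
    using words[of "[(c1, plane_vec d 0 0), (c2, plane_vec d 1 0), (c3, plane_vec d 0 1), (c4, plane_vec d 1 1)]"]
    by (simp add: plane_vec_carrier zero)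
  have seed: "disjoint_seq \<phi> [(map Some p, plane_vec d 0 0), (map Some c, plane_vec d (int v) 0)] \<longleftrightarrow>
      pairs_code [(word_code p, axis_code d 0), (word_code c, axis_code d v)] \<in> ?D" for c v
    using words[of "[(p, plane_vec d 0 0), (c, plane_vec d (int v) 0)]"]
    by (simp add: plane_vec_carrier zero vector_code_axis[OF assms])
  have quad: "pair a (pair b (pair c e)) \<in> quad_code ` W \<longleftrightarrow> (a, b, c, e) \<in> W" for a b c e
    using inj_image_mem_iff[OF inj_quad_code, of "(a, b, c, e)" W] by (simp add: quad_code_def)
  show ?thesis
    unfolding clopen_tiling_def rule_coded_def seed_coded_def all_words_iff rule seed quad by blast
qed

text \<open>
  Only finitely many labels matter, so a labelling can be replaced by a finite table.
\<close>

lemma clopen_tiling_table: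
  assumes "clopen_tiling d \<phi> W Q m lab p"
  shows "\<exists>t. clopen_tiling d \<phi> W Q m (\<lambda>w. cnth (word_code w) t) p"
proof -
  define t where "t = list_encode (map (\<lambda>c. lab (inv_into UNIV word_code c)) [0..<word_bound m])"
  have "cnth (word_code w) t = lab w" if "length w = m" for w
    using word_code_bound[of w] that by (simp add: t_def inv_f_f[OF inj_word_code])
  then have "clopen_tiling d \<phi> W Q m (\<lambda>w. cnth (word_code w) t) p \<longleftrightarrow> clopen_tiling d \<phi> W Q m lab p"
    unfolding clopen_tiling_def by (auto split: prod.splits)
  then show ?thesis using assms by blast
qed

text \<open>
  Effectiveness enters here: the \<open>\<phi>\<close>-disjoint sequences occur only positively.
\<close>

lemma clopen_tiling_RE:
  assumes "2 \<le> d" "effective d \<phi>" "finite W" "finite A0" "finite A1" "finite A2" "finite A3"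
  shows "RE (\<lambda>n. \<exists>m lab p. clopen_tiling d \<phi> W [(0, A0), (1, A1), (n, A2), (Suc n, A3)] m lab p)"
proof -
  let ?D = "disjoint_codes d \<phi>"
  have D: "RE (\<lambda>n. n \<in> ?D)"
    using assms(2) unfolding effective_def disjoint_codes_def by (rule recursively_enumerable_RE)
  have "RE (\<lambda>n. \<exists>m t p. is_word m p \<and> rule_coded d ?D m t (quad_code ` W) \<and>
      seed_coded d ?D m t p 0 A0 \<and> seed_coded d ?D m t p 1 A1 \<and>
      seed_coded d ?D m t p n A2 \<and> seed_coded d ?D m t p (Suc n) A3)"
    using assms(3-) by (intro RE_ex RE_conj RE_PRP[OF PRP_is_word] RE_rule_coded[OF D] RE_seed_coded[OF D]
      PR_Suc PR_pfst PR_psnd PR_id PR_const finite_imageI)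
  moreover have "(\<exists>m lab p. clopen_tiling d \<phi> W [(0, A0), (1, A1), (n, A2), (Suc n, A3)] m lab p) \<longleftrightarrow>
     (\<exists>m t p. is_word m p \<and> rule_coded d ?D m t (quad_code ` W) \<and>
      seed_coded d ?D m t p 0 A0 \<and> seed_coded d ?D m t p 1 A1 \<and>
      seed_coded d ?D m t p n A2 \<and> seed_coded d ?D m t p (Suc n) A3)" (is "?L = ?R") for n
  proof
    assume ?L
    then obtain m t p where "clopen_tiling d \<phi> W [(0, A0), (1, A1), (n, A2), (Suc n, A3)] m (\<lambda>w. cnth (word_code w) t) p"
      using clopen_tiling_table by blast
    then have "length p = m \<and> rule_coded d ?D m t (quad_code ` W) \<and>
      seed_coded d ?D m t (word_code p) 0 A0 \<and> seed_coded d ?D m t (word_code p) 1 A1 \<and>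
      seed_coded d ?D m t (word_code p) n A2 \<and> seed_coded d ?D m t (word_code p) (Suc n) A3"
      unfolding clopen_tiling_coded[OF assms(1)] by simp
    moreover from this have "is_word m (word_code p)" unfolding is_word_iff by blast
    ultimately show ?R by blast
  next
    assume ?R
    then obtain m t p where "length p = m \<and> rule_coded d ?D m t (quad_code ` W) \<and>
      seed_coded d ?D m t (word_code p) 0 A0 \<and> seed_coded d ?D m t (word_code p) 1 A1 \<and>
      seed_coded d ?D m t (word_code p) n A2 \<and> seed_coded d ?D m t (word_code p) (Suc n) A3"
      unfolding is_word_iff by blast
    then have "clopen_tiling d \<phi> W [(0, A0), (1, A1), (n, A2), (Suc n, A3)] m (\<lambda>w. cnth (word_code w) t) p"
      unfolding clopen_tiling_coded[OF assms(1)] by simp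
    then show ?L by blast
  qed
  ultimately show ?thesis by simp
qed

section \<open>No effective action has a dense conjugacy class\<close>

theorem theorem4:
  fixes d :: nat and \<phi> :: "(nat \<Rightarrow> int) \<Rightarrow> cantor \<Rightarrow> cantor"
  assumes "d \<ge> 2"
    and "\<phi> \<in> topspace (action_space d)"
    and "effective d \<phi>"
  shows "action_space d closure_of conjugacy_class d \<phi> \<noteq> topspace (action_space d)"
proof
  assume dense: "action_space d closure_of conjugacy_class d \<phi> = topspace (action_space d)"
  have "RE (\<lambda>n. accepts n n)" by (intro RE_accepts PR_id)
  then obtain c where c: "\<And>n. halts c n \<longleftrightarrow> accepts n n" using RE_halting_program by blast
  obtain W A0 A1 A2 A3 where fin: "finite W" "finite A0" "finite A1" "finite A2" "finite A3"
    and tilings: "\<And>n. (\<exists>X. valid_tiling W X \<and> seeded [(0, A0), (1, A1), (n, A2), (Suc n, A3)] X) \<longleftrightarrow> \<not> halts c n"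
    using seeded_tilings_encode_halting[of c] by metis
  have "(\<exists>m lab p. clopen_tiling d \<phi> W [(0, A0), (1, A1), (n, A2), (Suc n, A3)] m lab p) \<longleftrightarrow> \<not> accepts n n" for n
    using clopen_tiling_sound[OF assms(2)] clopen_tiling_complete[OF assms(1,2) dense fin(1)]
    unfolding c[symmetric] tilings[symmetric] by blast
  then have "RE (\<lambda>n. \<not> accepts n n)" using clopen_tiling_RE[OF assms(1,3) fin] by simp
  then show False using self_acceptance_not_co_RE by blast
qed

end
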